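(* Let $q$ be a real-valued, $1$-periodic function with $q\in L_1[0,1]$ and $\int_0^1 q(x)\,dx=0$, and let $\lambda_{n,1}\le\lambda_{n,2}$ be its large periodic eigenvalues. (a) If $q_{2n}=o(n^{-1})$ as $n\to\infty$, then $\lambda_{n,j}=(2\pi n)^2+o(n^{-1})$ for $j=1,2$. (b) Let $\varepsilon>0$ be fixed, let $N$ be a sufficiently large positive integer, and let $\mathbb N_1(\varepsilon)$ be the set of all $n\in\mathbb N$ with $n>N$ and $|q_{2n}|\ge\frac{\varepsilon}{n}$. Then the eigenvalues $\lambda_{n,j}$ for $n\in\mathbb N_1(\varepsilon)$ and $j=1,2$ are simple and satisfy $$\lambda_{n,j}=(2\pi n)^2+(-1)^j|q_{2n}|+o\left(\frac1n\right)$$ as $n\to\infty$, $n\in\mathbb N_1(\varepsilon)$.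
   Context: $L_0(q)$ is the operator in $L_2[0,1]$ generated by $-y''+qy$ with periodic boundary conditions $y(1)=y(0)$, $y'(1)=y'(0)$. Its large eigenvalues, counted with multiplicity, form two sequences $\lambda_{n,1}\le\lambda_{n,2}$ ($n\ge N_0$, $N_0$ a sufficiently large integer) with $\lambda_{n,j}=(2\pi n)^2+O(n^{1/2})$. The Fourier coefficients are $q_k=\int_0^1q(x)e^{-i2\pi kx}dx$. How large $N$ must be may depend on $q$ and $\varepsilon$. *)

theory Defs
  imports
    "HOL-Analysis.Analysis"
    "HOL-Library.Function_Algebras"
    "HOL-Library.Landau_Symbols"
begin

definition fourier_coeff :: "(real \<Rightarrow> real) \<Rightarrow> int \<Rightarrow> complex" where
  "fourier_coeff q k =
     integral {0..1} (\<lambda>x. of_real (q x) * exp (- (\<i> * 2 * of_real pi * of_int k * of_real x)))"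

definition square_integrable :: "(real \<Rightarrow> complex) \<Rightarrow> bool" where
  "square_integrable f \<longleftrightarrow>
     f \<in> borel_measurable (lebesgue_on {0..1}) \<and>
     integrable (lebesgue_on {0..1}) (\<lambda>x. (cmod (f x))\<^sup>2)"

text \<open>
  \<open>periodic_op q y f\<close> is the graph of the operator \<open>L\<^sub>0(q)\<close>: \<open>y\<close> is in the domain and
  \<open>L\<^sub>0(q) y = f\<close> as elements of \<open>L\<^sub>2[0,1]\<close>. The domain consists of the \<open>y\<close> with \<open>y\<close> and \<open>y'\<close>
  absolutely continuous on \<open>[0,1]\<close>, \<open>- y'' + q y\<close> in \<open>L\<^sub>2[0,1]\<close>, and \<open>y(1) = y(0)\<close>,
  \<open>y'(1) = y'(0)\<close>. Below, \<open>y1\<close> is \<open>y'\<close>, and its absolute continuity is expressed by saying that it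
  is an indefinite integral of an integrable function \<open>y2\<close>, which is then \<open>y''\<close> almost everywhere.
  An element of the domain is represented by its continuous representative on \<open>[0,1]\<close>, extended
  by zero to the real line, so that equality of functions is equality in \<open>L\<^sub>2[0,1]\<close>.
\<close>

definition periodic_op :: "(real \<Rightarrow> real) \<Rightarrow> (real \<Rightarrow> complex) \<Rightarrow> (real \<Rightarrow> complex) \<Rightarrow> bool" where
  "periodic_op q y f \<longleftrightarrow>
     (\<exists>y1 y2.
        (\<forall>x. x \<notin> {0..1} \<longrightarrow> y x = 0) \<and>
        (\<forall>x\<in>{0..1}. (y has_vector_derivative y1 x) (at x within {0..1})) \<and>
        y2 absolutely_integrable_on {0..1} \<and>
        (\<forall>x\<in>{0..1}. y1 x = y1 0 + integral {0..x} y2) \<and>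
        y 1 = y 0 \<and> y1 1 = y1 0 \<and>
        square_integrable f \<and>
        (AE x in lebesgue_on {0..1}. f x = - y2 x + of_real (q x) * y x))"

text \<open>
  The root space of \<open>L\<^sub>0(q)\<close> at \<open>\<mu>\<close>, i.e. the union over \<open>k\<close> of the kernels of
  \<open>(L\<^sub>0(q) - \<mu>)\<^sup>k\<close>: in the second rule, \<open>(L\<^sub>0(q) - \<mu>) y = z\<close>.
\<close>

inductive_set root_space :: "(real \<Rightarrow> real) \<Rightarrow> complex \<Rightarrow> (real \<Rightarrow> complex) set"
  for q :: "real \<Rightarrow> real" and \<mu> :: complex where
  zero: "(\<lambda>x. 0) \<in> root_space q \<mu>"
| step: "z \<in> root_space q \<mu> \<Longrightarrow> periodic_op q y (\<lambda>x. \<mu> * y x + z x) \<Longrightarrow> y \<in> root_space q \<mu>"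

global_interpretation cfun: vector_space "\<lambda>(c::complex) (f::real \<Rightarrow> complex) x. c * f x"
  defines cfun_dim = cfun.dim
  by unfold_locales (auto simp: fun_eq_iff algebra_simps)

text \<open>
  The multiplicity of \<open>\<mu>\<close> is the complex dimension of the root space (zero iff \<open>\<mu>\<close> is not an
  eigenvalue).
\<close>

definition eigenvalue_mult :: "(real \<Rightarrow> real) \<Rightarrow> complex \<Rightarrow> nat" where
  "eigenvalue_mult q \<mu> = cfun_dim (root_space q \<mu>)"

definition simple_eigenvalue :: "(real \<Rightarrow> real) \<Rightarrow> complex \<Rightarrow> bool" where
  "simple_eigenvalue q \<mu> \<longleftrightarrow> eigenvalue_mult q \<mu> = 1"

definition index_set :: "nat \<Rightarrow> (nat \<Rightarrow> nat \<Rightarrow> real) \<Rightarrow> complex \<Rightarrow> (nat \<times> nat) set" where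
  "index_set N\<^sub>0 ev \<mu> = {(n, j). n \<ge> N\<^sub>0 \<and> j \<in> {1, 2} \<and> complex_of_real (ev n j) = \<mu>}"

text \<open>
  The family \<open>ev n j\<close> (\<open>n \<ge> N\<^sub>0\<close>, \<open>j = 1, 2\<close>) lists the large eigenvalues of \<open>L\<^sub>0(q)\<close>, counted with
  multiplicity: it consists of eigenvalues, none repeated more often than its multiplicity
  permits, and every \<open>\<mu>\<close> of sufficiently large modulus occurs exactly as often as its multiplicity.
\<close>

definition large_periodic_eigenvalues ::
    "(real \<Rightarrow> real) \<Rightarrow> nat \<Rightarrow> (nat \<Rightarrow> nat \<Rightarrow> real) \<Rightarrow> bool" where
  "large_periodic_eigenvalues q N\<^sub>0 ev \<longleftrightarrow>
     (\<forall>n\<ge>N\<^sub>0. ev n 1 \<le> ev n 2) \<and>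
     (\<forall>\<mu>. finite (index_set N\<^sub>0 ev \<mu>) \<and> card (index_set N\<^sub>0 ev \<mu>) \<le> eigenvalue_mult q \<mu>) \<and>
     (\<exists>R. \<forall>\<mu>. cmod \<mu> > R \<longrightarrow> card (index_set N\<^sub>0 ev \<mu>) = eigenvalue_mult q \<mu>) \<and>
     (\<forall>j\<in>{1, 2}. (\<lambda>n. ev n j - (2 * pi * real n)\<^sup>2) \<in> O(\<lambda>n. sqrt (real n)))"

definition N1_set :: "(real \<Rightarrow> real) \<Rightarrow> real \<Rightarrow> nat \<Rightarrow> nat set" where
  "N1_set q \<epsilon> N = {n. n > N \<and> cmod (fourier_coeff q (2 * int n)) \<ge> \<epsilon> / real n}"

end

theory Submission
  imports Defs
begin

text \<open>
  Write an eigenvalue as \<open>\<lambda> = \<omega>\<^sup>2 + \<delta>\<close> with \<open>\<omega> = 2 \<pi> n\<close>, and put \<open>p = q - \<delta>\<close>, so that an eigenfunction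
  satisfies \<open>y'' + \<omega>\<^sup>2 y = p y\<close>. Variation of constants turns this into
  \<open>y x = \<alpha> x * cis (\<omega> x) + \<beta> x * cis (- \<omega> x)\<close>, where \<open>\<alpha>\<close> and \<open>\<beta>\<close> differ from their initial values
  \<open>a\<close> and \<open>b\<close> by primitives of \<open>p t * y t * cis (\<plusminus> \<omega> t)\<close> divided by \<open>2 \<i> \<omega>\<close>, hence by \<open>O(1/\<omega>)\<close>; and
  periodicity of \<open>y\<close> and \<open>y'\<close> says that these two primitives vanish at \<open>1\<close>. Replacing \<open>\<alpha>\<close>, \<open>\<beta>\<close> by
  \<open>a\<close>, \<open>b\<close> there gives, because the mean of \<open>q\<close> is zero, the approximate linear system

    \<open>- \<delta> a + q\<^sub>2\<^sub>n b \<approx> 0\<close>,  \<open>cnj q\<^sub>2\<^sub>n a - \<delta> b \<approx> 0\<close>.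

  If its error is \<open>o(1/n)\<close> relative to \<open>\<bar>a\<bar> + \<bar>b\<bar>\<close>, then \<open>\<bar>\<delta>\<bar> = \<bar>q\<^sub>2\<^sub>n\<bar> + o(1/n)\<close>
  (\<open>resonance_splitting\<close>), which contains (a) and, up to the sign of \<open>\<delta>\<close>, also (b).

  The crude error bound is of order \<open>(\<parallel>q\<parallel> + \<bar>\<delta>\<bar>)\<^sup>2/n\<close> (\<open>resonance_first_order\<close>). Starting from
  \<open>\<delta> = O(\<surd>n)\<close> it yields \<open>\<delta> = O(1)\<close>, and then, as \<open>q\<^sub>2\<^sub>n\<close> tends to zero, \<open>\<delta> = o(1)\<close>. To reach \<open>o(1/n)\<close>
  the amplitudes are expanded once more (\<open>resonance_second_order\<close>). The new terms of order \<open>1/n\<close> are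
  integrals of one of \<open>p\<close>, \<open>p t * cis (- 2 \<omega> t)\<close> against a primitive of another such function. Those
  that contain an oscillating primitive are \<open>o(1)\<close>, because the Riemann-Lebesgue lemma holds
  uniformly for all primitives (\<open>Riemann_Lebesgue_uniform\<close>); the term in which an oscillating function
  meets the primitive of \<open>p\<close> is brought into this form by integration by parts; and the only term without oscillation is \<open>\<integral> p (\<integral> p) = (\<integral> p)\<^sup>2 / 2 = \<delta>\<^sup>2 / 2\<close>, which is \<open>o(1)\<close> by the previous step.

  For (b), let \<open>\<bar>q\<^sub>2\<^sub>n\<bar> \<ge> \<epsilon>/n\<close>. Then the system determines the direction of \<open>(a, b)\<close> up to a small error,
  and this direction depends only on the sign of \<open>\<delta>\<close> (\<open>resonance_direction\<close>). So two eigenfunctions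
  with \<open>\<delta>\<close> of the same sign are nearly parallel in \<open>L\<^sub>2\<close> and cannot be orthogonal
  (\<open>aligned_not_orthogonal\<close>). As the operator is symmetric, eigenfunctions of different eigenvalues are
  orthogonal, root functions are eigenfunctions, and an eigenspace of dimension two contains an
  orthogonal pair. Hence the eigenvalues are simple and there is at most one on either side of
  \<open>\<omega>\<^sup>2\<close>; being listed with their multiplicity, \<open>ev n 1\<close> lies below and \<open>ev n 2\<close> above \<open>\<omega>\<^sup>2\<close>.
\<close>

section \<open>Approximation in the mean\<close>

definition L1_norm :: "real \<Rightarrow> real \<Rightarrow> (real \<Rightarrow> complex) \<Rightarrow> real" where
  "L1_norm a b f = integral {a..b} (\<lambda>x. norm (f x))"

lemma absolutely_integrable_difference:
  fixes f g :: "real \<Rightarrow> 'a::euclidean_space"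
  shows "f absolutely_integrable_on S \<Longrightarrow> g absolutely_integrable_on S \<Longrightarrow> (\<lambda>x. f x - g x) absolutely_integrable_on S"
  by (rule set_integral_diff)

lemma norm_integrable:
  fixes f :: "real \<Rightarrow> 'a::euclidean_space"
  shows "f absolutely_integrable_on S \<Longrightarrow> (\<lambda>x. norm (f x)) integrable_on S"
  by (simp add: absolutely_integrable_on_def)

lemma L1_norm_nonneg: "0 \<le> L1_norm a b f"
  unfolding L1_norm_def
  by (cases "(\<lambda>x. norm (f x)) integrable_on {a..b}")
     (auto intro: Henstock_Kurzweil_Integration.integral_nonneg simp: not_integrable_integral)

text \<open>
  Truncating the values at radius \<open>M\<close> leaves a function dominated by \<open>\<bar>f\<bar>\<close>, so dominated convergence
  applies as \<open>M\<close> grows.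
\<close>

lemma L1_approx_truncation:
  fixes f :: "real \<Rightarrow> complex"
  assumes f: "f absolutely_integrable_on {a..b}" and e: "e > 0"
  shows "\<exists>M>0. L1_norm a b (\<lambda>x. f x - (M / max M (norm (f x))) *\<^sub>R f x) < e"
proof -
  define g where "g n x = f x - (real (Suc n) / max (real (Suc n)) (norm (f x))) *\<^sub>R f x" for n x
  have fm: "f \<in> borel_measurable (lebesgue_on {a..b})"
    using f absolutely_integrable_imp_borel_measurable by fastforce
  have gm: "g n \<in> borel_measurable (lebesgue_on {a..b})" for n
    unfolding g_def using fm by measurable
  have bd: "norm (g n x) \<le> norm (f x)" for n x
  proof -
    define c where "c = real (Suc n) / max (real (Suc n)) (norm (f x))"
    have c: "0 \<le> c" "c \<le> 1" unfolding c_def by (auto simp: divide_simps)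
    have "g n x = (1 - c) *\<^sub>R f x" unfolding g_def c_def[symmetric] by (simp add: algebra_simps)
    then have "norm (g n x) = (1 - c) * norm (f x)" using c by simp
    also have "\<dots> \<le> 1 * norm (f x)" using c by (intro mult_right_mono) auto
    finally show ?thesis by simp
  qed
  have nf: "(\<lambda>x. norm (f x)) integrable_on {a..b}"
    using f by (rule norm_integrable)
  have gi: "(\<lambda>x. norm (g n x)) integrable_on {a..b}" for n
  proof -
    have "g n absolutely_integrable_on {a..b}"
      by (rule measurable_bounded_by_integrable_imp_absolutely_integrable[OF gm _ nf]) (use bd in auto)
    then show ?thesis by (rule norm_integrable)
  qed
  have lim: "(\<lambda>n. norm (g n x)) \<longlonglongrightarrow> 0" for x
  proof -
    obtain m where m: "norm (f x) < real m" using reals_Archimedean2 by blast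
    have "\<forall>\<^sub>F n in sequentially. norm (g n x) = 0"
      using eventually_ge_at_top[of m]
    proof eventually_elim
      case (elim n)
      then have "norm (f x) < real (Suc n)" using m by linarith
      then show ?case unfolding g_def by (simp add: max_def)
    qed
    then show ?thesis by (simp add: tendsto_eventually)
  qed
  have "(\<lambda>n. integral {a..b} (\<lambda>x. norm (g n x))) \<longlonglongrightarrow> integral {a..b} (\<lambda>x. 0::real)"
    by (rule dominated_convergence(2)[OF gi nf]) (use bd lim in auto)
  then have "\<forall>\<^sub>F n in sequentially. integral {a..b} (\<lambda>x. norm (g n x)) < e"
    using e by (intro order_tendstoD) auto
  then obtain n where "integral {a..b} (\<lambda>x. norm (g n x)) < e"
    using eventually_happens by force
  then show ?thesis
    unfolding L1_norm_def g_def by (intro exI[of _ "real (Suc n)"]) auto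
qed

lemma norm_truncation_le:
  fixes z :: complex
  assumes "M > 0"
  shows "norm ((M / max M (norm z)) *\<^sub>R z) \<le> M"
proof (cases "norm z \<le> M")
  case True
  then show ?thesis using assms by (simp add: max_absorb1)
next
  case False
  then have "max M (norm z) = norm z" "norm z > 0" using assms by (auto simp: max_def)
  then show ?thesis using assms by simp
qed

text \<open>
  A measurable function is a pointwise limit of continuous functions almost everywhere; truncated at the
  bound of \<open>h\<close>, these converge in the mean by dominated convergence.
\<close>

lemma L1_approx_continuous:
  fixes h :: "real \<Rightarrow> complex"
  assumes hm: "h \<in> borel_measurable (lebesgue_on {a..b})" and M: "M > 0"
    and hM: "\<And>x. x \<in> {a..b} \<Longrightarrow> norm (h x) \<le> M" and e: "e > 0"
  shows "\<exists>g. continuous_on UNIV g \<and> L1_norm a b (\<lambda>x. h x - g x) < e"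
proof -
  have "h measurable_on {a..b}"
    using hm by (simp add: measurable_on_iff_borel_measurable)
  then obtain N G where N: "negligible N" and G: "\<And>n. continuous_on UNIV (G n)"
    and lim: "\<And>x. x \<notin> N \<Longrightarrow> (\<lambda>n. G n x) \<longlonglongrightarrow> (if x \<in> {a..b} then h x else 0)"
    unfolding measurable_on_def by metis
  define g where "g n x = (M / max M (norm (G n x))) *\<^sub>R G n x" for n x
  have gc: "continuous_on UNIV (g n)" for n
    unfolding g_def using M by (intro continuous_intros G) (auto simp: max_def)
  define d where "d n x = (if x \<in> N then 0 else norm (h x - g n x))" for n x
  have gM: "norm (g n x) \<le> M" for n x unfolding g_def using M by (rule norm_truncation_le)
  have di: "(\<lambda>x. norm (h x - g n x)) integrable_on {a..b}" for n
  proof -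
    have "(\<lambda>x. h x - g n x) absolutely_integrable_on {a..b}"
    proof (rule measurable_bounded_by_integrable_imp_absolutely_integrable)
      have "g n \<in> borel_measurable (lebesgue_on {a..b})"
        using continuous_on_subset[OF gc] by (intro continuous_imp_measurable_on_sets_lebesgue) auto
      then show "(\<lambda>x. h x - g n x) \<in> borel_measurable (lebesgue_on {a..b})"
        using hm by measurable
      show "norm (h x - g n x) \<le> (\<lambda>x. 2 * M) x" if "x \<in> {a..b}" for x
        using norm_triangle_ineq4[of "h x" "g n x"] hM[OF that] gM[of n x] by simp
    qed auto
    then show ?thesis by (rule norm_integrable)
  qed
  have di': "d n integrable_on {a..b}" for n
    by (rule integrable_spike[OF di N]) (auto simp: d_def)
  have de: "integral {a..b} (d n) = L1_norm a b (\<lambda>x. h x - g n x)" for n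
    unfolding L1_norm_def by (rule integral_spike[OF N]) (auto simp: d_def)
  have "(\<lambda>n. integral {a..b} (d n)) \<longlonglongrightarrow> integral {a..b} (\<lambda>x. 0::real)"
  proof (rule dominated_convergence(2)[OF di'])
    show "(\<lambda>x. 2 * M) integrable_on {a..b}" by auto
    show "norm (d n x) \<le> 2 * M" if "x \<in> {a..b}" for n x
      using norm_triangle_ineq4[of "h x" "g n x"] hM[OF that] gM[of n x] M by (simp add: d_def)
    show "(\<lambda>n. d n x) \<longlonglongrightarrow> 0" if x: "x \<in> {a..b}" for x
    proof (cases "x \<in> N")
      case False
      have "(\<lambda>n. G n x) \<longlonglongrightarrow> h x" using lim[OF False] x by simp
      then have "(\<lambda>n. norm (h x - g n x)) \<longlonglongrightarrow> norm (h x - (M / max M (norm (h x))) *\<^sub>R h x)"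
        unfolding g_def using M by (intro tendsto_intros) (auto simp: max_def)
      moreover have "max M (norm (h x)) = M" using hM[OF x] by simp
      ultimately show ?thesis using False M by (simp add: d_def)
    qed (simp add: d_def)
  qed
  then have "\<forall>\<^sub>F n in sequentially. integral {a..b} (d n) < e"
    using e by (intro order_tendstoD) auto
  then obtain n where "integral {a..b} (d n) < e"
    using eventually_happens by force
  then show ?thesis using gc de by auto
qed

lemma L1_norm_triangle:
  assumes "f absolutely_integrable_on {a..b}" "g absolutely_integrable_on {a..b}"
  shows "L1_norm a b (\<lambda>x. f x + g x) \<le> L1_norm a b f + L1_norm a b g"
proof -
  have "(\<lambda>x. norm (f x)) integrable_on {a..b}" "(\<lambda>x. norm (g x)) integrable_on {a..b}"
    "(\<lambda>x. norm (f x + g x)) integrable_on {a..b}"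
    using norm_integrable[OF assms(1)] norm_integrable[OF assms(2)] norm_integrable[OF set_integral_add(1)[OF assms]] by auto
  then show ?thesis unfolding L1_norm_def
    by (subst integral_add[symmetric]) (auto intro!: integral_le integrable_add norm_triangle_ineq)
qed

lemma L1_norm_le_const:
  assumes "f absolutely_integrable_on {a..b}" "a \<le> b" "\<And>x. x \<in> {a..b} \<Longrightarrow> norm (f x) \<le> B"
  shows "L1_norm a b f \<le> B * (b - a)"
proof -
  have "integral {a..b} (\<lambda>x. norm (f x)) \<le> integral {a..b} (\<lambda>x. B)"
    using assms(2,3) norm_integrable[OF assms(1)] by (intro integral_le) auto
  then show ?thesis using assms by (simp add: L1_norm_def mult.commute)
qed

text \<open>
  Polynomials serve as the dense class because they are continuous, as integration by parts
  needs, and also continuously differentiable, as the Riemann-Lebesgue lemma needs.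
\<close>

lemma polynomial_dense_L1:
  fixes f :: "real \<Rightarrow> complex"
  assumes f: "f absolutely_integrable_on {a..b}" and ab: "a \<le> b" and e: "e > 0"
  obtains g where "polynomial_function g" "L1_norm a b (\<lambda>x. f x - g x) < e"
proof -
  obtain M where M: "M > 0" and fM: "L1_norm a b (\<lambda>x. f x - (M / max M (norm (f x))) *\<^sub>R f x) < e/3"
    using L1_approx_truncation[OF f, of "e/3"] e by (meson divide_pos_pos zero_less_numeral)
  define h where "h x = (M / max M (norm (f x))) *\<^sub>R f x" for x
  have fm: "f \<in> borel_measurable (lebesgue_on {a..b})"
    using f absolutely_integrable_imp_borel_measurable by fastforce
  have hm: "h \<in> borel_measurable (lebesgue_on {a..b})"
    unfolding h_def using fm by measurable
  have hM: "norm (h x) \<le> M" for x unfolding h_def using M by (rule norm_truncation_le)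
  have hA: "h absolutely_integrable_on {a..b}"
    by (rule measurable_bounded_by_integrable_imp_absolutely_integrable[OF hm, of "\<lambda>_. M"]) (use hM in auto)
  obtain c where c: "continuous_on UNIV c" and hc: "L1_norm a b (\<lambda>x. h x - c x) < e/3"
    using L1_approx_continuous[OF hm M hM, of "e/3"] e by auto
  have cA: "c absolutely_integrable_on {a..b}"
    using continuous_on_subset[OF c] by (intro absolutely_integrable_continuous_real) auto
  define e' where "e' = e / (4 * (b - a + 1))"
  have e': "e' > 0" unfolding e'_def using e ab by auto
  obtain g where g: "polynomial_function g" and cg: "\<And>x. x \<in> {a..b} \<Longrightarrow> norm (c x - g x) < e'"
    using Stone_Weierstrass_polynomial_function[of "{a..b}" c e'] e' continuous_on_subset[OF c] by auto
  have gA: "g absolutely_integrable_on {a..b}"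
    using continuous_on_polymonial_function[OF g] by (intro absolutely_integrable_continuous_real) auto
  have "L1_norm a b (\<lambda>x. c x - g x) \<le> e' * (b - a)"
    by (rule L1_norm_le_const[OF absolutely_integrable_difference[OF cA gA] ab]) (use cg in force)
  also have "\<dots> < e/3"
  proof -
    have "a * e \<le> b * e" using mult_right_mono[OF ab, of e] e by simp
    then have "a * e < b * e + e * 4" using e by linarith
    then show ?thesis unfolding e'_def using e ab by (simp add: field_simps)
  qed
  finally have 3: "L1_norm a b (\<lambda>x. c x - g x) < e/3" .
  have "L1_norm a b (\<lambda>x. (h x - c x) + (c x - g x)) \<le> L1_norm a b (\<lambda>x. h x - c x) + L1_norm a b (\<lambda>x. c x - g x)"
    by (rule L1_norm_triangle[OF absolutely_integrable_difference[OF hA cA] absolutely_integrable_difference[OF cA gA]])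
  moreover have "L1_norm a b (\<lambda>x. (f x - h x) + (h x - g x)) \<le> L1_norm a b (\<lambda>x. f x - h x) + L1_norm a b (\<lambda>x. h x - g x)"
    by (rule L1_norm_triangle[OF absolutely_integrable_difference[OF f hA] absolutely_integrable_difference[OF hA gA]])
  ultimately have "L1_norm a b (\<lambda>x. f x - g x) < e"
    using 3 hc fM unfolding h_def by simp
  with g show ?thesis by (rule that)
qed

section \<open>Products and primitives of integrable functions\<close>

lemma absolutely_integrable_mult_continuous:
  fixes f g :: "real \<Rightarrow> complex"
  assumes f: "f absolutely_integrable_on {a..b}" and g: "continuous_on {a..b} g"
  shows "(\<lambda>x. f x * g x) absolutely_integrable_on {a..b}"
proof -
  have "(\<lambda>x. g x * f x) absolutely_integrable_on {a..b}"
  proof (rule absolutely_integrable_bounded_measurable_product[OF bilinear_times _ _ _ f])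
    show "g \<in> borel_measurable (lebesgue_on {a..b})"
      using g by (intro continuous_imp_measurable_on_sets_lebesgue) auto
    show "bounded (g ` {a..b})"
      using g by (intro compact_imp_bounded compact_continuous_image) auto
  qed auto
  then show ?thesis by (simp add: mult.commute)
qed

lemma absolutely_integrable_initial_segment:
  fixes f :: "real \<Rightarrow> complex"
  assumes "f absolutely_integrable_on {a..b}" "x \<in> {a..b}"
  shows "f absolutely_integrable_on {a..x}"
  using assms by (intro absolutely_integrable_on_subinterval[OF assms(1)]) auto

lemma L1_norm_mono:
  assumes "f absolutely_integrable_on {a..b}" "x \<in> {a..b}"
  shows "L1_norm a x f \<le> L1_norm a b f"
  unfolding L1_norm_def
  using assms(2) norm_integrable[OF assms(1)] norm_integrable[OF absolutely_integrable_initial_segment[OF assms]]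
  by (intro integral_subset_le) auto

lemma L1_norm_mult_le:
  assumes f: "f absolutely_integrable_on {a..b}" and g: "continuous_on {a..b} g"
    and B: "\<And>x. x \<in> {a..b} \<Longrightarrow> norm (g x) \<le> B"
  shows "L1_norm a b (\<lambda>x. f x * g x) \<le> B * L1_norm a b f"
proof -
  have "integral {a..b} (\<lambda>x. norm (f x * g x)) \<le> integral {a..b} (\<lambda>x. B * norm (f x))"
  proof (rule integral_le)
    show "(\<lambda>x. norm (f x * g x)) integrable_on {a..b}" by (rule norm_integrable[OF absolutely_integrable_mult_continuous[OF f g]])
    show "(\<lambda>x. B * norm (f x)) integrable_on {a..b}"
      using norm_integrable[OF f] by (rule integrable_on_mult_right)
    show "norm (f x * g x) \<le> B * norm (f x)" if "x \<in> {a..b}" for x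
      using mult_right_mono[OF B[OF that] norm_ge_zero[of "f x"]] by (simp add: norm_mult mult.commute)
  qed
  then show ?thesis by (simp add: L1_norm_def)
qed

lemma norm_integral_le_L1_norm:
  assumes "f absolutely_integrable_on {a..b}"
  shows "norm (integral {a..b} f) \<le> L1_norm a b f"
  unfolding L1_norm_def
  using assms norm_integrable[OF assms] by (intro integral_norm_bound_integral) (auto dest: set_lebesgue_integral_eq_integral(1))

lemma norm_integral_mult_le:
  assumes f: "f absolutely_integrable_on {a..b}" and g: "continuous_on {a..b} g"
    and B: "\<And>x. x \<in> {a..b} \<Longrightarrow> norm (g x) \<le> B"
  shows "norm (integral {a..b} (\<lambda>x. f x * g x)) \<le> B * L1_norm a b f"
  using norm_integral_le_L1_norm[OF absolutely_integrable_mult_continuous[OF f g]] L1_norm_mult_le[OF assms] by linarith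

lemma absolutely_integrable_integrable:
  fixes f :: "real \<Rightarrow> complex"
  shows "f absolutely_integrable_on S \<Longrightarrow> f integrable_on S"
  by (rule set_lebesgue_integral_eq_integral(1))

lemma continuous_primitive:
  fixes f :: "real \<Rightarrow> complex"
  assumes "f absolutely_integrable_on {a..b}"
  shows "continuous_on {a..b} (\<lambda>x. integral {a..x} f)"
  using absolutely_integrable_integrable[OF assms] by (rule indefinite_integral_continuous_1)

lemma norm_primitive_le:
  assumes "f absolutely_integrable_on {a..b}" "x \<in> {a..b}"
  shows "norm (integral {a..x} f) \<le> L1_norm a b f"
  using norm_integral_le_L1_norm[OF absolutely_integrable_initial_segment[OF assms]] L1_norm_mono[OF assms] by linarith

section \<open>Integration by parts for absolutely continuous functions\<close>

lemma product_of_primitives_continuous: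
  fixes g h :: "real \<Rightarrow> complex"
  assumes ab: "a \<le> b" and g: "continuous_on {a..b} g" and h: "continuous_on {a..b} h"
  shows "integral {a..b} (\<lambda>x. g x * integral {a..x} h + h x * integral {a..x} g)
       = integral {a..b} g * integral {a..b} h"
proof -
  have "((\<lambda>x. g x * integral {a..x} h + h x * integral {a..x} g) has_integral
      integral {a..b} g * integral {a..b} h - integral {a..a} g * integral {a..a} h) {a..b}"
  proof (rule fundamental_theorem_of_calculus[OF ab])
    fix x assume x: "x \<in> {a..b}"
    have "((\<lambda>x. integral {a..x} g * integral {a..x} h) has_vector_derivative
        (integral {a..x} g * h x + g x * integral {a..x} h)) (at x within {a..b})"
      by (rule has_vector_derivative_mult integral_has_vector_derivative g h x)+
    then show "((\<lambda>x. integral {a..x} g * integral {a..x} h) has_vector_derivative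
        (g x * integral {a..x} h + h x * integral {a..x} g)) (at x within {a..b})"
      by (simp add: algebra_simps)
  qed
  then show ?thesis by (simp add: integral_unique)
qed

text \<open>
  Both sides are bilinear in \<open>(g, h)\<close> and continuous in the mean, and for continuous \<open>g\<close> and \<open>h\<close> the
  equation is the fundamental theorem of calculus; density of polynomials gives the general case. The
  fundamental theorem itself does not apply, as the primitives are differentiable only almost everywhere.
\<close>

lemma product_of_primitives:
  fixes g h :: "real \<Rightarrow> complex"
  assumes ab: "a \<le> b" and g: "g absolutely_integrable_on {a..b}" and h: "h absolutely_integrable_on {a..b}"
  shows "integral {a..b} (\<lambda>x. g x * integral {a..x} h) + integral {a..b} (\<lambda>x. h x * integral {a..x} g)
       = integral {a..b} g * integral {a..b} h"
proof -
  let ?AI = "\<lambda>f. (f :: real \<Rightarrow> complex) absolutely_integrable_on {a..b}"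
  define S where "S u v = integral {a..b} (\<lambda>x. u x * integral {a..x} v)" for u v :: "real \<Rightarrow> complex"
  define D where "D u v = integral {a..b} u * integral {a..b} v - S u v - S v u" for u v
  have Sdiff1: "S (\<lambda>x. u x - u' x) v = S u v - S u' v" if "?AI u" "?AI u'" "?AI v" for u u' v
    unfolding S_def left_diff_distrib using that
    by (intro integral_diff absolutely_integrable_integrable absolutely_integrable_mult_continuous continuous_primitive)
  have Sdiff2: "S v (\<lambda>x. u x - u' x) = S v u - S v u'" if "?AI u" "?AI u'" "?AI v" for u u' v
  proof -
    have "S v (\<lambda>x. u x - u' x) = integral {a..b} (\<lambda>x. v x * integral {a..x} u - v x * integral {a..x} u')"
      unfolding S_def
    proof (rule integral_cong)
      fix x assume x: "x \<in> {a..b}"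
      show "v x * integral {a..x} (\<lambda>x. u x - u' x) = v x * integral {a..x} u - v x * integral {a..x} u'"
        using absolutely_integrable_integrable[OF absolutely_integrable_initial_segment[OF that(1) x]] absolutely_integrable_integrable[OF absolutely_integrable_initial_segment[OF that(2) x]]
        by (simp add: integral_diff algebra_simps)
    qed
    also have "\<dots> = S v u - S v u'"
      unfolding S_def using that
      by (intro integral_diff absolutely_integrable_integrable absolutely_integrable_mult_continuous continuous_primitive)
    finally show ?thesis .
  qed
  have Sbd: "norm (S u v) \<le> L1_norm a b u * L1_norm a b v" if "?AI u" "?AI v" for u v
    unfolding S_def mult.commute[of "L1_norm a b u"] using that
    by (intro norm_integral_mult_le continuous_primitive norm_primitive_le)
  have Dbd: "norm (D u v) \<le> 3 * L1_norm a b u * L1_norm a b v" if "?AI u" "?AI v" for u v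
  proof -
    have "norm (integral {a..b} u * integral {a..b} v) \<le> L1_norm a b u * L1_norm a b v"
      unfolding norm_mult using that by (intro mult_mono norm_integral_le_L1_norm L1_norm_nonneg) auto
    moreover have "norm (D u v) \<le> norm (integral {a..b} u * integral {a..b} v) + norm (S u v) + norm (S v u)"
      unfolding D_def by (meson norm_triangle_ineq4 order_trans add_mono order_refl)
    ultimately show ?thesis using Sbd[OF that] Sbd[OF that(2,1)]
      by (simp add: mult.commute[of "L1_norm a b v"])
  qed
  have Ddec: "D g h = D (\<lambda>x. g x - u x) h + D u (\<lambda>x. h x - v x) + D u v" if "?AI u" "?AI v" for u v
    using that g h by (simp add: D_def Sdiff1 Sdiff2 absolutely_integrable_difference integral_diff absolutely_integrable_integrable algebra_simps)
  have "norm (D g h) \<le> e" if e: "e > 0" for e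
  proof -
    define K where "K = 3 * (L1_norm a b g + L1_norm a b h + 1)"
    have K: "K > 0" unfolding K_def using L1_norm_nonneg[of a b g] L1_norm_nonneg[of a b h] by simp
    define d where "d = min 1 (e / K)"
    have d: "d > 0" "d \<le> 1" "d * K \<le> e" unfolding d_def using e K by (auto simp: min_def field_simps)
    obtain u where u: "polynomial_function u" "L1_norm a b (\<lambda>x. g x - u x) < d"
      using polynomial_dense_L1[OF g ab d(1)] by blast
    obtain v where v: "polynomial_function v" "L1_norm a b (\<lambda>x. h x - v x) < d"
      using polynomial_dense_L1[OF h ab d(1)] by blast
    have uc: "continuous_on {a..b} u" and vc: "continuous_on {a..b} v"
      using u v by (auto intro: continuous_on_polymonial_function)
    then have uA: "?AI u" and vA: "?AI v"
      by (auto intro: absolutely_integrable_continuous_real)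
    have "S u v + S v u = integral {a..b} u * integral {a..b} v"
      unfolding S_def product_of_primitives_continuous[OF ab uc vc, symmetric]
      by (rule integral_add[symmetric])
         (intro absolutely_integrable_integrable absolutely_integrable_mult_continuous continuous_primitive uA vA)+
    then have D0: "D u v = 0" by (simp add: D_def diff_diff_eq)
    have "L1_norm a b u \<le> L1_norm a b g + d"
    proof -
      have "L1_norm a b (\<lambda>x. g x + (u x - g x)) \<le> L1_norm a b g + L1_norm a b (\<lambda>x. u x - g x)"
        by (rule L1_norm_triangle[OF g absolutely_integrable_difference[OF uA g]])
      then show ?thesis using u(2) by (simp add: L1_norm_def norm_minus_commute)
    qed
    then have u1: "L1_norm a b u \<le> L1_norm a b g + 1" using d by linarith
    have "norm (D g h) \<le> norm (D (\<lambda>x. g x - u x) h) + norm (D u (\<lambda>x. h x - v x))"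
      using Ddec[OF uA vA] D0 norm_triangle_ineq by simp
    also have "\<dots> \<le> 3 * L1_norm a b (\<lambda>x. g x - u x) * L1_norm a b h
                    + 3 * L1_norm a b u * L1_norm a b (\<lambda>x. h x - v x)"
      by (intro add_mono Dbd absolutely_integrable_difference g h uA vA)
    also have "\<dots> \<le> 3 * d * L1_norm a b h + 3 * (L1_norm a b g + 1) * d"
      using u v u1 d L1_norm_nonneg[of a b g] by (intro add_mono mult_mono L1_norm_nonneg) auto
    also have "\<dots> = d * K" by (simp add: K_def algebra_simps)
    finally show ?thesis using d by simp
  qed
  then have "norm (D g h) \<le> 0" by (rule field_le_epsilon) simp
  then show ?thesis by (simp add: D_def S_def algebra_simps)
qed

lemma integration_by_parts_AC:
  fixes u v u' v' :: "real \<Rightarrow> complex"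
  assumes ab: "a \<le> b"
    and u': "u' absolutely_integrable_on {a..b}" and v': "v' absolutely_integrable_on {a..b}"
    and u: "\<And>x. x \<in> {a..b} \<Longrightarrow> u x = u a + integral {a..x} u'"
    and v: "\<And>x. x \<in> {a..b} \<Longrightarrow> v x = v a + integral {a..x} v'"
  shows "integral {a..b} (\<lambda>x. u' x * v x) + integral {a..b} (\<lambda>x. v' x * u x) = u b * v b - u a * v a"
proof -
  have 1: "integral {a..b} (\<lambda>x. f' x * w x) = w a * integral {a..b} f' + integral {a..b} (\<lambda>x. f' x * integral {a..x} w')"
    if "f' absolutely_integrable_on {a..b}" "w' absolutely_integrable_on {a..b}"
       "\<And>x. x \<in> {a..b} \<Longrightarrow> w x = w a + integral {a..x} w'" for f' w w' :: "real \<Rightarrow> complex"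
  proof -
    have "integral {a..b} (\<lambda>x. f' x * w x) = integral {a..b} (\<lambda>x. w a * f' x + f' x * integral {a..x} w')"
    proof (rule integral_cong)
      show "f' x * w x = w a * f' x + f' x * integral {a..x} w'" if "x \<in> {a..b}" for x
        using \<open>\<And>x. x \<in> {a..b} \<Longrightarrow> w x = w a + integral {a..x} w'\<close>[OF that] by (simp add: algebra_simps)
    qed
    also have "\<dots> = w a * integral {a..b} f' + integral {a..b} (\<lambda>x. f' x * integral {a..x} w')"
      using that by (subst integral_add)
        (auto intro!: absolutely_integrable_integrable absolutely_integrable_mult_continuous continuous_primitive integrable_on_mult_right)
    finally show ?thesis .
  qed
  have "u b = u a + integral {a..b} u'" "v b = v a + integral {a..b} v'"
    using u[of b] v[of b] ab by auto
  then show ?thesis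
    using 1[OF u' v' v] 1[OF v' u' u] product_of_primitives[OF ab u' v']
    by (simp add: algebra_simps)
qed

section \<open>The Riemann-Lebesgue lemma\<close>

lemma has_vector_derivative_cis:
  "((\<lambda>t. cis (c * t)) has_vector_derivative \<i> * c * cis (c * t)) (at t within S)"
proof -
  have eq: "exp (t *\<^sub>R (\<i> * complex_of_real c)) = cis (c * t)" for t
    by (simp add: cis_conv_exp scaleR_conv_of_real mult_ac)
  show ?thesis
    using exp_scaleR_has_vector_derivative_right[of "\<i> * complex_of_real c" t S]
    unfolding eq by (simp add: mult.commute)
qed

lemma norm_imaginary_multiple: "\<i> * complex_of_real c * z = w \<Longrightarrow> \<bar>c\<bar> * norm z = norm w"
  by (auto simp: norm_mult)

text \<open>
  The bound is uniform in the upper limit of integration. For a polynomial one integration by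
  parts shows this, since the boundary terms and the total variation are bounded on \<open>{a..b}\<close>; an
  approximation in the mean is uniform in the upper limit as well.
\<close>

lemma Riemann_Lebesgue_uniform:
  fixes f :: "real \<Rightarrow> complex"
  assumes f: "f absolutely_integrable_on {a..b}" and ab: "a \<le> b" and e: "e > 0"
  obtains C where "C > 0"
    "\<And>c x. \<bar>c\<bar> \<ge> C \<Longrightarrow> x \<in> {a..b} \<Longrightarrow> norm (integral {a..x} (\<lambda>t. f t * cis (c * t))) \<le> e"
proof -
  obtain g where g: "polynomial_function g" and fg: "L1_norm a b (\<lambda>x. f x - g x) < e/2"
    using polynomial_dense_L1[OF f ab, of "e/2"] e by (metis half_gt_zero)
  obtain g' where g': "polynomial_function g'" and gd: "\<And>x. (g has_vector_derivative g' x) (at x)"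
    using has_vector_derivative_polynomial_function[OF g] by blast
  have gc: "continuous_on {a..b} g" and g'c: "continuous_on {a..b} g'"
    using g g' by (auto intro: continuous_on_polymonial_function)
  then have gA: "g absolutely_integrable_on {a..b}" and g'A: "g' absolutely_integrable_on {a..b}"
    by (auto intro: absolutely_integrable_continuous_real)
  have "bounded (g ` {a..b})" using gc by (intro compact_imp_bounded compact_continuous_image) auto
  then obtain B where B: "B > 0" "\<And>x. x \<in> {a..b} \<Longrightarrow> norm (g x) \<le> B"
    unfolding bounded_pos by auto
  define K where "K = 2 * B + L1_norm a b g'"
  have K: "K > 0" unfolding K_def using B L1_norm_nonneg[of a b g'] by linarith
  show ?thesis
  proof (rule that)
    show "2 * K / e > 0" using K e by simp
    fix c x :: real assume c: "\<bar>c\<bar> \<ge> 2 * K / e" and x: "x \<in> {a..b}"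
    have cc: "continuous_on S (\<lambda>t. cis (c * t))" for S by (intro continuous_intros)
    have gx: "g absolutely_integrable_on {a..x}" "g' absolutely_integrable_on {a..x}"
      "(\<lambda>x. f x - g x) absolutely_integrable_on {a..x}"
      using absolutely_integrable_initial_segment[OF gA x] absolutely_integrable_initial_segment[OF g'A x] absolutely_integrable_initial_segment[OF absolutely_integrable_difference[OF f gA] x] by auto
    have "((\<lambda>t. g' t * cis (c * t) + \<i> * c * (g t * cis (c * t))) has_integral
        g x * cis (c * x) - g a * cis (c * a)) {a..x}"
    proof (rule fundamental_theorem_of_calculus)
      fix t assume "t \<in> {a..x}"
      have "((\<lambda>t. g t * cis (c * t)) has_vector_derivative
          g t * (\<i> * c * cis (c * t)) + g' t * cis (c * t)) (at t within {a..x})"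
        by (rule has_vector_derivative_mult[OF has_vector_derivative_at_within[OF gd] has_vector_derivative_cis])
      moreover have "g t * (\<i> * c * cis (c * t)) + g' t * cis (c * t) = g' t * cis (c * t) + \<i> * c * (g t * cis (c * t))"
        by (simp only: ac_simps)
      ultimately show "((\<lambda>t. g t * cis (c * t)) has_vector_derivative
          g' t * cis (c * t) + \<i> * c * (g t * cis (c * t))) (at t within {a..x})"
        by (simp only:)
    qed (use x in auto)
    moreover have "((\<lambda>t. g' t * cis (c * t) + \<i> * c * (g t * cis (c * t))) has_integral
        integral {a..x} (\<lambda>t. g' t * cis (c * t)) + \<i> * c * integral {a..x} (\<lambda>t. g t * cis (c * t))) {a..x}"
      by (intro has_integral_add has_integral_mult_right integrable_integral absolutely_integrable_integrable
          absolutely_integrable_mult_continuous cc gx)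
    ultimately have "integral {a..x} (\<lambda>t. g' t * cis (c * t)) + \<i> * c * integral {a..x} (\<lambda>t. g t * cis (c * t))
      = g x * cis (c * x) - g a * cis (c * a)"
      by (rule has_integral_unique[symmetric])
    then have "\<i> * c * integral {a..x} (\<lambda>t. g t * cis (c * t))
      = g x * cis (c * x) - g a * cis (c * a) - integral {a..x} (\<lambda>t. g' t * cis (c * t))"
      by (simp add: algebra_simps)
    then have "\<bar>c\<bar> * norm (integral {a..x} (\<lambda>t. g t * cis (c * t)))
      = norm (g x * cis (c * x) - g a * cis (c * a) - integral {a..x} (\<lambda>t. g' t * cis (c * t)))"
      by (rule norm_imaginary_multiple)
    also have "\<dots> \<le> norm (g x * cis (c * x)) + norm (g a * cis (c * a)) + norm (integral {a..x} (\<lambda>t. g' t * cis (c * t)))"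
      by (rule order_trans[OF norm_triangle_ineq4 add_right_mono[OF norm_triangle_ineq4]])
    also have "\<dots> \<le> B + B + 1 * L1_norm a x g'"
    proof (intro add_mono)
      show "norm (integral {a..x} (\<lambda>t. g' t * cis (c * t))) \<le> 1 * L1_norm a x g'"
        by (rule norm_integral_mult_le[OF gx(2) cc]) simp
    qed (use x B in \<open>auto simp: norm_mult\<close>)
    also have "\<dots> \<le> K" unfolding K_def using L1_norm_mono[OF g'A x] by simp
    finally have "\<bar>c\<bar> * norm (integral {a..x} (\<lambda>t. g t * cis (c * t))) \<le> K" .
    moreover have "2 * K / e * norm (integral {a..x} (\<lambda>t. g t * cis (c * t))) \<le> \<bar>c\<bar> * norm (integral {a..x} (\<lambda>t. g t * cis (c * t)))"
      by (rule mult_right_mono[OF c]) simp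
    ultimately have "2 * K / e * norm (integral {a..x} (\<lambda>t. g t * cis (c * t))) \<le> K" by linarith
    then have 1: "norm (integral {a..x} (\<lambda>t. g t * cis (c * t))) \<le> e / 2"
      using K e by (simp add: field_simps)
    have 2: "norm (integral {a..x} (\<lambda>t. (f t - g t) * cis (c * t))) \<le> e/2"
      using norm_integral_mult_le[OF gx(3) cc, of 1] L1_norm_mono[OF absolutely_integrable_difference[OF f gA] x] fg by simp
    have "integral {a..x} (\<lambda>t. f t * cis (c * t)) =
       integral {a..x} (\<lambda>t. (f t - g t) * cis (c * t) + g t * cis (c * t))"
      by (simp add: algebra_simps)
    also have "\<dots> = integral {a..x} (\<lambda>t. (f t - g t) * cis (c * t)) + integral {a..x} (\<lambda>t. g t * cis (c * t))"
      by (intro integral_add absolutely_integrable_integrable absolutely_integrable_mult_continuous cc gx)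
    finally have "integral {a..x} (\<lambda>t. f t * cis (c * t)) =
       integral {a..x} (\<lambda>t. (f t - g t) * cis (c * t)) + integral {a..x} (\<lambda>t. g t * cis (c * t))" .
    then show "norm (integral {a..x} (\<lambda>t. f t * cis (c * t))) \<le> e"
      using norm_triangle_ineq[of "integral {a..x} (\<lambda>t. (f t - g t) * cis (c * t))" "integral {a..x} (\<lambda>t. g t * cis (c * t))"] 1 2 by simp
  qed
qed

section \<open>Slowly varying amplitudes\<close>

lemma continuous_on_cis_mult: "continuous_on S (\<lambda>t. cis (c * t))"
  by (intro continuous_intros)

text \<open>
  The amplitudes \<open>\<alpha>\<close> and \<open>\<beta>\<close> of \<open>y\<close> with respect to \<open>cis (\<plusminus> \<omega> x)\<close> satisfy the Volterra equations of
  variation of constants. In the application \<open>p = q - \<delta>\<close> and \<open>P\<close> bounds its norm. The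
  sign of \<open>\<omega>\<close> is left open so that a symmetry can be used: exchanging \<open>(\<omega>, \<alpha>, \<beta>, a, b)\<close> for
  \<open>(- \<omega>, \<beta>, \<alpha>, b, a)\<close> preserves all assumptions and turns the first equation of the resonance system
  into the second.
\<close>

context
  fixes p y \<alpha> \<beta> :: "real \<Rightarrow> complex" and \<omega> P :: real and a b :: complex
  assumes p: "p absolutely_integrable_on {0..1}" and pP: "L1_norm 0 1 p \<le> P"
    and P\<omega>: "2 * P \<le> \<bar>\<omega>\<bar>" and \<omega>: "\<omega> \<noteq> 0"
    and y: "continuous_on {0..1} y"
    and y_eq: "\<And>x. x \<in> {0..1} \<Longrightarrow> y x = \<alpha> x * cis (\<omega> * x) + \<beta> x * cis (- \<omega> * x)"
    and \<alpha>: "\<And>x. x \<in> {0..1} \<Longrightarrow> \<alpha> x = a + integral {0..x} (\<lambda>t. p t * (y t * cis (- \<omega> * t))) / (2 * \<i> * \<omega>)"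
    and \<beta>: "\<And>x. x \<in> {0..1} \<Longrightarrow> \<beta> x = b - integral {0..x} (\<lambda>t. p t * (y t * cis (\<omega> * t))) / (2 * \<i> * \<omega>)"
begin

lemma modulated_solution_continuous: "continuous_on {0..1} (\<lambda>t. y t * cis (c * t))"
  by (intro continuous_intros y)

lemma amplitudes_continuous: "continuous_on {0..1} \<alpha>" "continuous_on {0..1} \<beta>"
proof -
  have "continuous_on {0..1} (\<lambda>x. a + integral {0..x} (\<lambda>t. p t * (y t * cis (- \<omega> * t))) / (2 * \<i> * \<omega>))"
    "continuous_on {0..1} (\<lambda>x. b - integral {0..x} (\<lambda>t. p t * (y t * cis (\<omega> * t))) / (2 * \<i> * \<omega>))"
    using \<omega> by (intro continuous_intros continuous_primitive absolutely_integrable_mult_continuous[OF p] modulated_solution_continuous; simp)+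
  then show "continuous_on {0..1} \<alpha>" "continuous_on {0..1} \<beta>"
    by (simp_all only: \<alpha> \<beta> cong: continuous_on_cong)
qed

lemma potential_bound_nonneg: "0 \<le> P"
  using L1_norm_nonneg[of 0 1 p] pP by linarith

lemma amplitude_deviation_sup:
  assumes M: "\<And>x. x \<in> {0..1} \<Longrightarrow> norm (y x) \<le> M" and x: "x \<in> {0..1}"
  shows "norm (\<alpha> x - a) \<le> P * M / (2 * \<bar>\<omega>\<bar>)" "norm (\<beta> x - b) \<le> P * M / (2 * \<bar>\<omega>\<bar>)"
proof -
  have M0: "M \<ge> 0" using M[of 0] norm_ge_zero[of "y 0"] by (meson atLeastAtMost_iff order_trans order_refl zero_le_one)
  have b: "norm (integral {0..x} (\<lambda>t. p t * (y t * cis (c * t)))) \<le> P * M" for c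
  proof -
    have "norm (integral {0..x} (\<lambda>t. p t * (y t * cis (c * t)))) \<le> L1_norm 0 1 (\<lambda>t. p t * (y t * cis (c * t)))"
      by (rule norm_primitive_le[OF absolutely_integrable_mult_continuous[OF p modulated_solution_continuous] x])
    also have "\<dots> \<le> M * L1_norm 0 1 p"
      by (rule L1_norm_mult_le[OF p modulated_solution_continuous]) (simp add: norm_mult M)
    also have "\<dots> \<le> M * P" by (rule mult_left_mono[OF pP M0])
    finally show ?thesis by (simp add: mult.commute)
  qed
  show "norm (\<alpha> x - a) \<le> P * M / (2 * \<bar>\<omega>\<bar>)"
    using divide_right_mono[OF b[of "-\<omega>"], of "2 * \<bar>\<omega>\<bar>"] by (simp add: \<alpha>[OF x] norm_divide norm_mult)
  show "norm (\<beta> x - b) \<le> P * M / (2 * \<bar>\<omega>\<bar>)"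
    using divide_right_mono[OF b[of \<omega>], of "2 * \<bar>\<omega>\<bar>"] by (simp add: \<beta>[OF x] norm_divide norm_mult)
qed

text \<open>
  At a maximum point of \<open>\<bar>y\<bar>\<close> the amplitudes exceed \<open>a\<close> and \<open>b\<close> in total by at most \<open>P M / \<bar>\<omega>\<bar> \<le> M / 2\<close>, where \<open>M\<close>
  is the maximum; the excess can be absorbed on the left.
\<close>

lemma solution_sup_bound:
  assumes "x \<in> {0..1}"
  shows "norm (y x) \<le> 2 * (norm a + norm b)"
proof -
  have "compact {0..1::real}" "{0..1::real} \<noteq> {}" by auto
  moreover have "continuous_on {0..1} (\<lambda>x. norm (y x))" using y by (intro continuous_intros)
  ultimately obtain x0 where x0: "x0 \<in> {0..1}" "\<forall>x\<in>{0..1}. norm (y x) \<le> norm (y x0)"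
    using continuous_attains_sup by metis
  define M where "M = norm (y x0)"
  have M: "norm (y x) \<le> M" if "x \<in> {0..1}" for x using x0 that by (simp add: M_def)
  note dev = amplitude_deviation_sup[OF M x0(1)]
  have "M \<le> norm (\<alpha> x0) + norm (\<beta> x0)"
    unfolding M_def y_eq[OF x0(1)] using norm_triangle_ineq[of "\<alpha> x0 * cis (\<omega> * x0)" "\<beta> x0 * cis (- \<omega> * x0)"]
    by (simp add: norm_mult)
  also have "\<dots> \<le> norm a + norm b + 2 * (P * M / (2 * \<bar>\<omega>\<bar>))"
    using dev norm_triangle_sub[of "\<alpha> x0" a] norm_triangle_sub[of "\<beta> x0" b] by linarith
  also have "2 * (P * M / (2 * \<bar>\<omega>\<bar>)) \<le> M / 2"
  proof -
    have "2 * P * M \<le> \<bar>\<omega>\<bar> * M" using P\<omega> by (rule mult_right_mono) (simp add: M_def)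
    then show ?thesis using \<omega> by (simp add: field_simps)
  qed
  finally have "M \<le> 2 * (norm a + norm b)" by simp
  then show ?thesis using M[OF assms] by linarith
qed

lemma amplitude_deviation:
  assumes x: "x \<in> {0..1}"
  shows "norm (\<alpha> x - a) \<le> P * (norm a + norm b) / \<bar>\<omega>\<bar>" "norm (\<beta> x - b) \<le> P * (norm a + norm b) / \<bar>\<omega>\<bar>"
proof -
  have "P * (2 * (norm a + norm b)) / (2 * \<bar>\<omega>\<bar>) = P * (norm a + norm b) / \<bar>\<omega>\<bar>"
    using \<omega> by (simp add: field_simps)
  then show "norm (\<alpha> x - a) \<le> P * (norm a + norm b) / \<bar>\<omega>\<bar>" "norm (\<beta> x - b) \<le> P * (norm a + norm b) / \<bar>\<omega>\<bar>"
    using amplitude_deviation_sup[OF solution_sup_bound x] by simp_all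
qed

lemma solution_approx:
  assumes x: "x \<in> {0..1}"
  shows "norm (y x - (a * cis (\<omega> * x) + b * cis (- \<omega> * x))) \<le> 2 * P * (norm a + norm b) / \<bar>\<omega>\<bar>"
proof -
  have "y x - (a * cis (\<omega> * x) + b * cis (- \<omega> * x)) = (\<alpha> x - a) * cis (\<omega> * x) + (\<beta> x - b) * cis (- \<omega> * x)"
    by (simp add: y_eq[OF x] algebra_simps)
  also have "norm \<dots> \<le> norm (\<alpha> x - a) + norm (\<beta> x - b)"
    using norm_triangle_ineq[of "(\<alpha> x - a) * cis (\<omega> * x)" "(\<beta> x - b) * cis (- \<omega> * x)"]
    by (simp add: norm_mult)
  finally show ?thesis using amplitude_deviation[OF x] by simp
qed

lemma modulated_potential_absolutely_integrable: "(\<lambda>t. p t * cis (c * t)) absolutely_integrable_on {0..1}"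
  by (rule absolutely_integrable_mult_continuous[OF p continuous_on_cis_mult])

lemma modulated_potential_L1_norm_le: "L1_norm 0 1 (\<lambda>t. p t * cis (c * t)) \<le> P"
  using L1_norm_mult_le[OF p continuous_on_cis_mult[of _ c], of 1] pP by simp

text \<open>
  The integrals that determine the amplitudes, with the frozen amplitudes \<open>a\<close> and \<open>b\<close> split off. The
  relevant values are \<open>c = - \<omega>\<close> and \<open>c = \<omega>\<close>, for which one of the two remaining phases is zero.
\<close>

lemma resonance_expansion:
  assumes x: "x \<in> {0..1}"
  shows "integral {0..x} (\<lambda>t. p t * (y t * cis (c * t))) - a * integral {0..x} (\<lambda>t. p t * cis ((c + \<omega>) * t))
      - b * integral {0..x} (\<lambda>t. p t * cis ((c - \<omega>) * t))
    = integral {0..x} (\<lambda>t. (p t * cis ((c + \<omega>) * t)) * (\<alpha> t - a))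
      + integral {0..x} (\<lambda>t. (p t * cis ((c - \<omega>) * t)) * (\<beta> t - b))"
    (is "?A - a * ?B - b * ?C = ?D + ?E")
proof -
  note AI = absolutely_integrable_integrable[OF absolutely_integrable_initial_segment[OF _ x]]
  have D: "(\<lambda>t. (p t * cis ((c + \<omega>) * t)) * (\<alpha> t - a)) integrable_on {0..x}"
    and E: "(\<lambda>t. (p t * cis ((c - \<omega>) * t)) * (\<beta> t - b)) integrable_on {0..x}"
    by (intro AI absolutely_integrable_mult_continuous modulated_potential_absolutely_integrable continuous_intros amplitudes_continuous)+
  have B: "(\<lambda>t. a * (p t * cis ((c + \<omega>) * t))) integrable_on {0..x}"
    and C: "(\<lambda>t. b * (p t * cis ((c - \<omega>) * t))) integrable_on {0..x}"
    by (intro integrable_on_mult_right AI modulated_potential_absolutely_integrable)+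
  have "?A = integral {0..x} (\<lambda>t. ((p t * cis ((c + \<omega>) * t)) * (\<alpha> t - a) + (p t * cis ((c - \<omega>) * t)) * (\<beta> t - b))
      + (a * (p t * cis ((c + \<omega>) * t)) + b * (p t * cis ((c - \<omega>) * t))))"
  proof (rule integral_cong)
    fix t assume "t \<in> {0..x}"
    then have t: "t \<in> {0..1}" using x by auto
    have "cis ((c + \<omega>) * t) = cis (\<omega> * t) * cis (c * t)" "cis ((c - \<omega>) * t) = cis (- \<omega> * t) * cis (c * t)"
      by (simp_all add: cis_mult algebra_simps)
    then show "p t * (y t * cis (c * t)) = ((p t * cis ((c + \<omega>) * t)) * (\<alpha> t - a) + (p t * cis ((c - \<omega>) * t)) * (\<beta> t - b))
      + (a * (p t * cis ((c + \<omega>) * t)) + b * (p t * cis ((c - \<omega>) * t)))"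
      by (simp add: y_eq[OF t] algebra_simps)
  qed
  also have "\<dots> = (?D + ?E) + (a * ?B + b * ?C)"
    by (simp only: integral_add integrable_add integral_mult_right D E B C)
  finally show ?thesis by simp
qed

lemma resonance_remainder_bound:
  assumes x: "x \<in> {0..1}"
  shows "norm (integral {0..x} (\<lambda>t. p t * (y t * cis (c * t))) - a * integral {0..x} (\<lambda>t. p t * cis ((c + \<omega>) * t))
      - b * integral {0..x} (\<lambda>t. p t * cis ((c - \<omega>) * t))) \<le> 2 * P\<^sup>2 * (norm a + norm b) / \<bar>\<omega>\<bar>"
proof -
  let ?d = "P * (norm a + norm b) / \<bar>\<omega>\<bar>"
  have d: "?d \<ge> 0" using potential_bound_nonneg by simp
  have bd: "norm (integral {0..x} (\<lambda>t. (p t * cis (k * t)) * w t)) \<le> ?d * P"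
    if w: "continuous_on {0..1} w" "\<And>t. t \<in> {0..1} \<Longrightarrow> norm (w t) \<le> ?d" for k w
  proof -
    have "norm (integral {0..x} (\<lambda>t. (p t * cis (k * t)) * w t)) \<le> L1_norm 0 1 (\<lambda>t. (p t * cis (k * t)) * w t)"
      by (rule norm_primitive_le[OF absolutely_integrable_mult_continuous[OF modulated_potential_absolutely_integrable w(1)] x])
    also have "\<dots> \<le> ?d * L1_norm 0 1 (\<lambda>t. p t * cis (k * t))"
      by (rule L1_norm_mult_le[OF modulated_potential_absolutely_integrable w])
    also have "\<dots> \<le> ?d * P" using modulated_potential_L1_norm_le d by (rule mult_left_mono)
    finally show ?thesis .
  qed
  have "norm (integral {0..x} (\<lambda>t. (p t * cis ((c + \<omega>) * t)) * (\<alpha> t - a))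
      + integral {0..x} (\<lambda>t. (p t * cis ((c - \<omega>) * t)) * (\<beta> t - b))) \<le> ?d * P + ?d * P"
    by (intro norm_triangle_mono bd continuous_intros amplitudes_continuous amplitude_deviation)
  then show ?thesis unfolding resonance_expansion[OF x] by (simp add: power2_eq_square mult_ac)
qed

text \<open>
  Under the hypothesis \<open>zero\<close>, which expresses periodicity, the frozen part of the expansion at
  \<open>x = 1\<close> is minus the remainder.
\<close>

lemma resonance_first_order:
  assumes zero: "integral {0..1} (\<lambda>t. p t * (y t * cis (- \<omega> * t))) = 0"
  shows "norm (a * integral {0..1} p + b * integral {0..1} (\<lambda>t. p t * cis (- 2 * \<omega> * t)))
     \<le> 2 * P\<^sup>2 * (norm a + norm b) / \<bar>\<omega>\<bar>"
proof -
  have "norm (- (a * integral {0..1} p + b * integral {0..1} (\<lambda>t. p t * cis (- 2 * \<omega> * t))))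
     \<le> 2 * P\<^sup>2 * (norm a + norm b) / \<bar>\<omega>\<bar>"
    using resonance_remainder_bound[of 1 "-\<omega>"] zero by simp
  then show ?thesis by (simp only: norm_minus_cancel)
qed

text \<open>
  The gain over the first-order bound is the factor \<open>m\<close>, which tends to zero in the application. In the
  remainder of the first-order expansion, \<open>\<alpha> - a\<close> and \<open>\<beta> - b\<close> are replaced by their own first-order
  expansions in terms of \<open>T\<close>, \<open>V\<close>, \<open>U\<close>, the primitives of \<open>p\<close> modulated by \<open>1\<close>, \<open>cis (- 2 \<omega> t)\<close>, \<open>cis (2 \<omega> t)\<close>.
\<close>

lemma resonance_second_order:
  assumes zero: "integral {0..1} (\<lambda>t. p t * (y t * cis (- \<omega> * t))) = 0"
    and m1: "norm (integral {0..1} p) \<le> m"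
    and mV: "\<And>x. x \<in> {0..1} \<Longrightarrow> norm (integral {0..x} (\<lambda>t. p t * cis (- 2 * \<omega> * t))) \<le> m"
    and mU: "\<And>x. x \<in> {0..1} \<Longrightarrow> norm (integral {0..x} (\<lambda>t. p t * cis (2 * \<omega> * t))) \<le> m"
  shows "norm (a * integral {0..1} p + b * integral {0..1} (\<lambda>t. p t * cis (- 2 * \<omega> * t)))
     \<le> (norm a + norm b) * (3 * m * P / (2 * \<bar>\<omega>\<bar>) + 2 * P ^ 3 / \<omega>\<^sup>2)"
proof -
  let ?s = "norm a + norm b"
  have m0: "0 \<le> m" using m1 norm_ge_zero order_trans by blast
  define pe where "pe t = p t * cis (- 2 * \<omega> * t)" for t
  define T V U where "T x = integral {0..x} p" and "V x = integral {0..x} pe"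
    and "U x = integral {0..x} (\<lambda>t. p t * cis (2 * \<omega> * t))" for x
  have pe: "pe absolutely_integrable_on {0..1}" and peP: "L1_norm 0 1 pe \<le> P"
    unfolding pe_def[abs_def] by (rule modulated_potential_absolutely_integrable modulated_potential_L1_norm_le)+
  have cont: "continuous_on {0..1} T" "continuous_on {0..1} V" "continuous_on {0..1} U"
    unfolding T_def V_def U_def by (intro continuous_primitive p pe modulated_potential_absolutely_integrable)+
  define r1 r2 where "r1 x = integral {0..x} (\<lambda>t. p t * (y t * cis (- \<omega> * t))) - a * T x - b * V x"
    and "r2 x = integral {0..x} (\<lambda>t. p t * (y t * cis (\<omega> * t))) - a * U x - b * T x" for x
  have r_cont: "continuous_on {0..1} r1" "continuous_on {0..1} r2"
    unfolding r1_def r2_def by (intro continuous_intros cont continuous_primitive absolutely_integrable_mult_continuous[OF p] modulated_solution_continuous)+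
  have r1: "norm (r1 x) \<le> 2 * P\<^sup>2 * ?s / \<bar>\<omega>\<bar>" if "x \<in> {0..1}" for x
    using resonance_remainder_bound[OF that, of "-\<omega>"] by (simp add: r1_def T_def V_def pe_def[abs_def])
  have r2: "norm (r2 x) \<le> 2 * P\<^sup>2 * ?s / \<bar>\<omega>\<bar>" if "x \<in> {0..1}" for x
    using resonance_remainder_bound[OF that, of \<omega>] by (simp add: r2_def T_def U_def)
  define \<kappa> where "\<kappa> = 1 / (2 * \<i> * \<omega>)"
  have \<kappa>: "norm \<kappa> = 1 / (2 * \<bar>\<omega>\<bar>)" by (simp add: \<kappa>_def norm_divide norm_mult)
  have int3: "integral {0..1} (\<lambda>t. f t * (u1 * w1 t + u2 * w2 t + w3 t))
     = u1 * integral {0..1} (\<lambda>t. f t * w1 t) + u2 * integral {0..1} (\<lambda>t. f t * w2 t) + integral {0..1} (\<lambda>t. f t * w3 t)"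
    if "f absolutely_integrable_on {0..1}" "continuous_on {0..1} w1" "continuous_on {0..1} w2" "continuous_on {0..1} w3"
    for f w1 w2 w3 :: "real \<Rightarrow> complex" and u1 u2
  proof -
    have i: "(\<lambda>t. f t * w1 t) integrable_on {0..1}" "(\<lambda>t. f t * w2 t) integrable_on {0..1}" "(\<lambda>t. f t * w3 t) integrable_on {0..1}"
      by (intro absolutely_integrable_integrable absolutely_integrable_mult_continuous that)+
    have "integral {0..1} (\<lambda>t. f t * (u1 * w1 t + u2 * w2 t + w3 t))
      = integral {0..1} (\<lambda>t. u1 * (f t * w1 t) + u2 * (f t * w2 t) + f t * w3 t)"
      by (simp add: algebra_simps)
    also have "\<dots> = u1 * integral {0..1} (\<lambda>t. f t * w1 t) + u2 * integral {0..1} (\<lambda>t. f t * w2 t) + integral {0..1} (\<lambda>t. f t * w3 t)"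
      by (simp only: integral_add integrable_add integral_mult_right integrable_on_mult_right i)
    finally show ?thesis .
  qed
  have A: "integral {0..1} (\<lambda>t. p t * (\<alpha> t - a)) = \<kappa> * (a * integral {0..1} (\<lambda>t. p t * T t)
      + b * integral {0..1} (\<lambda>t. p t * V t) + integral {0..1} (\<lambda>t. p t * r1 t))"
  proof -
    have "integral {0..1} (\<lambda>t. p t * (\<alpha> t - a)) = integral {0..1} (\<lambda>t. \<kappa> * (p t * (a * T t + b * V t + r1 t)))"
      by (rule integral_cong) (simp add: \<alpha> r1_def \<kappa>_def)
    then show ?thesis using int3[OF p cont(1,2) r_cont(1)] by (simp only: integral_mult_right)
  qed
  have B: "integral {0..1} (\<lambda>t. pe t * (\<beta> t - b)) = - \<kappa> * (a * integral {0..1} (\<lambda>t. pe t * U t)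
      + b * integral {0..1} (\<lambda>t. pe t * T t) + integral {0..1} (\<lambda>t. pe t * r2 t))"
  proof -
    have "integral {0..1} (\<lambda>t. pe t * (\<beta> t - b)) = integral {0..1} (\<lambda>t. - \<kappa> * (pe t * (a * U t + b * T t + r2 t)))"
      by (rule integral_cong) (simp add: \<beta> r2_def \<kappa>_def)
    then show ?thesis using int3[OF pe cont(3,1) r_cont(2)] by (simp only: integral_mult_right)
  qed
  have bnd: "norm (integral {0..1} (\<lambda>t. f t * w t)) \<le> d * P"
    if "f absolutely_integrable_on {0..1}" "L1_norm 0 1 f \<le> P" "continuous_on {0..1} w"
      "\<And>x. x \<in> {0..1} \<Longrightarrow> norm (w x) \<le> d" for f w :: "real \<Rightarrow> complex" and d
  proof -
    have "d \<ge> 0" using that(4)[of 0] norm_ge_zero[of "w 0"] by (meson atLeastAtMost_iff order_trans order_refl zero_le_one)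
    then show ?thesis
      using norm_integral_mult_le[OF that(1,3,4)] mult_left_mono[OF that(2)] by fastforce
  qed
  have T1: "norm (T 1) \<le> m" "norm (T 1) \<le> P" and V1: "norm (V 1) \<le> m"
    using m1 mV[of 1] norm_integral_le_L1_norm[OF p] pP by (auto simp: T_def V_def pe_def[abs_def])
  \<comment> \<open>the term without oscillation: the integral is half the square of \<open>T 1\<close>\<close>
  have pT: "norm (integral {0..1} (\<lambda>t. p t * T t)) \<le> m * P"
  proof -
    have "integral {0..1} (\<lambda>t. p t * T t) + integral {0..1} (\<lambda>t. p t * T t) = T 1 * T 1"
      using product_of_primitives[OF _ p p] by (simp add: T_def)
    then have "2 * integral {0..1} (\<lambda>t. p t * T t) = T 1 * T 1" by simp
    then have "2 * norm (integral {0..1} (\<lambda>t. p t * T t)) = norm (T 1) * norm (T 1)"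
      by (metis norm_mult norm_numeral)
    also have "\<dots> \<le> m * P" using T1 m0 by (intro mult_mono) auto
    finally show ?thesis using norm_ge_zero[of "integral {0..1} (\<lambda>t. p t * T t)"] by linarith
  qed
  have pV: "norm (integral {0..1} (\<lambda>t. p t * V t)) \<le> m * P"
    by (rule bnd[OF p pP cont(2)]) (use mV in \<open>simp add: V_def pe_def[abs_def]\<close>)
  have peU: "norm (integral {0..1} (\<lambda>t. pe t * U t)) \<le> m * P"
    by (rule bnd[OF pe peP cont(3)]) (use mU in \<open>simp add: U_def\<close>)
  \<comment> \<open>\<open>T\<close> does not oscillate; integration by parts exchanges it for \<open>V\<close>\<close>
  have peT: "norm (integral {0..1} (\<lambda>t. pe t * T t)) \<le> 2 * m * P"
  proof -
    have "integral {0..1} (\<lambda>t. pe t * T t) = V 1 * T 1 - integral {0..1} (\<lambda>t. p t * V t)"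
      using product_of_primitives[OF _ pe p] by (simp add: T_def V_def eq_diff_eq)
    moreover have "norm (V 1 * T 1) \<le> m * P"
      unfolding norm_mult using T1 V1 m0 by (intro mult_mono) auto
    ultimately show ?thesis using pV norm_triangle_ineq4[of "V 1 * T 1" "integral {0..1} (\<lambda>t. p t * V t)"] by simp
  qed
  have pr: "norm (integral {0..1} (\<lambda>t. p t * r1 t)) \<le> 2 * P\<^sup>2 * ?s / \<bar>\<omega>\<bar> * P"
    by (rule bnd[OF p pP r_cont(1) r1])
  have per: "norm (integral {0..1} (\<lambda>t. pe t * r2 t)) \<le> 2 * P\<^sup>2 * ?s / \<bar>\<omega>\<bar> * P"
    by (rule bnd[OF pe peP r_cont(2) r2])
  have nA: "norm (integral {0..1} (\<lambda>t. p t * (\<alpha> t - a))) \<le> (1 / (2 * \<bar>\<omega>\<bar>)) * (norm a * (m * P) + norm b * (m * P) + 2 * P\<^sup>2 * ?s / \<bar>\<omega>\<bar> * P)"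
    unfolding A norm_mult \<kappa>
    by (intro mult_left_mono norm_triangle_mono pr) (auto simp: norm_mult intro!: mult_left_mono pT pV)
  have nB: "norm (integral {0..1} (\<lambda>t. pe t * (\<beta> t - b))) \<le> (1 / (2 * \<bar>\<omega>\<bar>)) * (norm a * (m * P) + norm b * (2 * m * P) + 2 * P\<^sup>2 * ?s / \<bar>\<omega>\<bar> * P)"
    unfolding B norm_mult norm_minus_cancel \<kappa>
    by (intro mult_left_mono norm_triangle_mono per) (auto simp: norm_mult intro!: mult_left_mono peU peT)
  have "- (a * T 1 + b * V 1) = integral {0..1} (\<lambda>t. p t * (\<alpha> t - a)) + integral {0..1} (\<lambda>t. pe t * (\<beta> t - b))"
    using resonance_expansion[of 1 "-\<omega>"] zero by (simp add: T_def V_def pe_def[abs_def])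
  then have "norm (a * T 1 + b * V 1) = norm (integral {0..1} (\<lambda>t. p t * (\<alpha> t - a)) + integral {0..1} (\<lambda>t. pe t * (\<beta> t - b)))"
    by (metis norm_minus_cancel)
  also have "\<dots> \<le> (1 / (2 * \<bar>\<omega>\<bar>)) * (norm a * (m * P) + norm b * (m * P) + 2 * P\<^sup>2 * ?s / \<bar>\<omega>\<bar> * P)
       + (1 / (2 * \<bar>\<omega>\<bar>)) * (norm a * (m * P) + norm b * (2 * m * P) + 2 * P\<^sup>2 * ?s / \<bar>\<omega>\<bar> * P)"
    by (rule norm_triangle_mono[OF nA nB])
  also have "\<dots> = (1 / (2 * \<bar>\<omega>\<bar>)) * (2 * norm a * (m * P) + 3 * norm b * (m * P) + 4 * P\<^sup>2 * ?s / \<bar>\<omega>\<bar> * P)"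
    by (simp add: algebra_simps)
  also have "\<dots> \<le> (1 / (2 * \<bar>\<omega>\<bar>)) * (3 * ?s * (m * P) + 4 * P\<^sup>2 * ?s / \<bar>\<omega>\<bar> * P)"
  proof -
    have "2 * norm a * (m * P) \<le> 3 * norm a * (m * P)"
      using m0 potential_bound_nonneg by (intro mult_right_mono) auto
    then show ?thesis by (intro mult_left_mono) (auto simp: algebra_simps)
  qed
  also have "\<dots> = ?s * (3 * m * P / (2 * \<bar>\<omega>\<bar>) + 2 * P ^ 3 / \<omega>\<^sup>2)"
    using \<omega> by (simp add: field_simps power2_eq_square power3_eq_cube abs_mult_self_eq flip: abs_mult)
  finally show ?thesis by (simp add: T_def V_def pe_def[abs_def])
qed

end

section \<open>The periodic operator\<close>

lemma AE_lebesgue_on_negligible: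
  assumes "AE x in lebesgue_on S. R x" "S \<in> sets lebesgue"
  obtains N where "negligible N" "\<And>x. x \<in> S - N \<Longrightarrow> R x"
proof -
  have "AE x in lebesgue. x \<in> S \<longrightarrow> R x"
    using assms by (simp add: AE_restrict_space_iff)
  then obtain N where "N \<in> null_sets lebesgue" "{x \<in> space lebesgue. \<not> (x \<in> S \<longrightarrow> R x)} \<subseteq> N"
    unfolding eventually_ae_filter by blast
  then show ?thesis by (intro that[of N]) (auto simp: negligible_iff_null_sets)
qed

lemma periodic_op_data:
  assumes "periodic_op q y f"
  shows "\<exists>y1 y2 N. (\<forall>x. x \<notin> {0..1} \<longrightarrow> y x = 0) \<and> continuous_on {0..1} y \<and> continuous_on {0..1} y1 \<and>
    y2 absolutely_integrable_on {0..1} \<and>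
    (\<forall>x\<in>{0..1}. y x = y 0 + integral {0..x} y1) \<and>
    (\<forall>x\<in>{0..1}. y1 x = y1 0 + integral {0..x} y2) \<and>
    y 1 = y 0 \<and> y1 1 = y1 0 \<and>
    negligible N \<and> (\<forall>x\<in>{0..1} - N. f x = - y2 x + of_real (q x) * y x)"
proof -
  obtain y1 y2 where out: "\<forall>x. x \<notin> {0..1} \<longrightarrow> y x = 0"
    and d: "\<forall>x\<in>{0..1}. (y has_vector_derivative y1 x) (at x within {0..1})"
    and y2: "y2 absolutely_integrable_on {0..1}"
    and y1: "\<forall>x\<in>{0..1}. y1 x = y1 0 + integral {0..x} y2"
    and per: "y 1 = y 0" "y1 1 = y1 0"
    and ae: "AE x in lebesgue_on {0..1}. f x = - y2 x + of_real (q x) * y x"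
    using assms unfolding periodic_op_def by blast
  have yc: "continuous_on {0..1} y"
    using d has_vector_derivative_continuous unfolding continuous_on_eq_continuous_within by blast
  have "continuous_on {0..1} (\<lambda>x. y1 0 + integral {0..x} y2)"
    by (intro continuous_intros continuous_primitive y2)
  then have y1c: "continuous_on {0..1} y1"
    by (rule continuous_on_eq) (erule y1[rule_format, symmetric])
  have y: "y x = y 0 + integral {0..x} y1" if x: "x \<in> {0..1}" for x
  proof -
    have "(y1 has_integral y x - y 0) {0..x}"
    proof (rule fundamental_theorem_of_calculus)
      show "(y has_vector_derivative y1 t) (at t within {0..x})" if "t \<in> {0..x}" for t
      proof (rule has_vector_derivative_within_subset)
        show "(y has_vector_derivative y1 t) (at t within {0..1})" using d that x by auto
        show "{0..x} \<subseteq> {0..1}" using x by auto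
      qed
    qed (use x in auto)
    then show ?thesis by (simp add: integral_unique)
  qed
  obtain N where N: "negligible N" "\<And>x. x \<in> {0..1} - N \<Longrightarrow> f x = - y2 x + of_real (q x) * y x"
    using AE_lebesgue_on_negligible[OF ae] by auto
  show ?thesis
    using out yc y1c y2 y y1 per N by blast
qed

lemma absolutely_integrable_of_real:
  fixes q :: "real \<Rightarrow> real"
  assumes "q absolutely_integrable_on S"
  shows "(\<lambda>x. complex_of_real (q x)) absolutely_integrable_on S"
  using absolutely_integrable_linear[OF assms bounded_linear_of_real] by (simp only: o_def)

text \<open>
  As \<open>q\<close> is real, the operator commutes with conjugation. This turns the bilinear Green identity into
  symmetry for the inner product.
\<close>

lemma periodic_op_cnj:
  assumes "periodic_op q y f"
  shows "periodic_op q (\<lambda>x. cnj (y x)) (\<lambda>x. cnj (f x))"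
proof -
  obtain y1 y2 where out: "\<forall>x. x \<notin> {0..1} \<longrightarrow> y x = 0"
    and d: "\<forall>x\<in>{0..1}. (y has_vector_derivative y1 x) (at x within {0..1})"
    and y2: "y2 absolutely_integrable_on {0..1}"
    and y1: "\<forall>x\<in>{0..1}. y1 x = y1 0 + integral {0..x} y2"
    and per: "y 1 = y 0" "y1 1 = y1 0"
    and sq: "square_integrable f"
    and ae: "AE x in lebesgue_on {0..1}. f x = - y2 x + of_real (q x) * y x"
    using assms unfolding periodic_op_def by blast
  have y1': "cnj (y1 x) = cnj (y1 0) + integral {0..x} (\<lambda>x. cnj (y2 x))" if "x \<in> {0..1}" for x
    using y1[rule_format, OF that] by (simp add: integral_cnj)
  have y2': "(\<lambda>x. cnj (y2 x)) absolutely_integrable_on {0..1}"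
    using absolutely_integrable_linear[OF y2 bounded_linear_cnj] by (simp add: o_def)
  have sq': "square_integrable (\<lambda>x. cnj (f x))"
  proof -
    have "cnj \<in> borel_measurable borel"
      by (intro borel_measurable_continuous_onI continuous_intros)
    then show ?thesis
      using sq measurable_compose[of f "lebesgue_on {0..1}" borel cnj borel]
      unfolding square_integrable_def by simp
  qed
  have ae': "AE x in lebesgue_on {0..1}. cnj (f x) = - cnj (y2 x) + of_real (q x) * cnj (y x)"
    using ae by eventually_elim simp
  show ?thesis
    unfolding periodic_op_def
    by (rule exI[of _ "\<lambda>x. cnj (y1 x)"], rule exI[of _ "\<lambda>x. cnj (y2 x)"])
       (intro conjI ballI allI impI has_vector_derivative_cnj y1' y2' sq' ae'; use out d per in simp)
qed

text \<open>
  Green's identity: two integrations by parts move both derivatives from \<open>y\<close> to \<open>z\<close>, and the boundary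
  terms cancel by periodicity.
\<close>

lemma periodic_op_symmetric:
  assumes q: "q absolutely_integrable_on {0..1}" and y: "periodic_op q y f" and z: "periodic_op q z g"
  shows "integral {0..1} (\<lambda>x. f x * z x) = integral {0..1} (\<lambda>x. y x * g x)"
proof -
  obtain y1 y2 N where Y: "continuous_on {0..1} y" "continuous_on {0..1} y1"
    "y2 absolutely_integrable_on {0..1}"
    "\<forall>x\<in>{0..1}. y x = y 0 + integral {0..x} y1"
    "\<forall>x\<in>{0..1}. y1 x = y1 0 + integral {0..x} y2"
    "y 1 = y 0" "y1 1 = y1 0"
    "negligible N" "\<forall>x\<in>{0..1} - N. f x = - y2 x + of_real (q x) * y x"
    using periodic_op_data[OF y] by blast
  obtain z1 z2 M where Z: "continuous_on {0..1} z" "continuous_on {0..1} z1"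
    "z2 absolutely_integrable_on {0..1}"
    "\<forall>x\<in>{0..1}. z x = z 0 + integral {0..x} z1"
    "\<forall>x\<in>{0..1}. z1 x = z1 0 + integral {0..x} z2"
    "z 1 = z 0" "z1 1 = z1 0"
    "negligible M" "\<forall>x\<in>{0..1} - M. g x = - z2 x + of_real (q x) * z x"
    using periodic_op_data[OF z] by blast
  have y1A: "y1 absolutely_integrable_on {0..1}" and z1A: "z1 absolutely_integrable_on {0..1}"
    using Y(2) Z(2) by (auto intro: absolutely_integrable_continuous_real)
  have "integral {0..1} (\<lambda>x. y2 x * z x) + integral {0..1} (\<lambda>x. z1 x * y1 x) = 0"
    using integration_by_parts_AC[OF _ Y(3) z1A Y(5)[rule_format] Z(4)[rule_format]] Y(6,7) Z(6,7) by simp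
  moreover have "integral {0..1} (\<lambda>x. z2 x * y x) + integral {0..1} (\<lambda>x. y1 x * z1 x) = 0"
    using integration_by_parts_AC[OF _ Z(3) y1A Z(5)[rule_format] Y(4)[rule_format]] Y(6,7) Z(6,7) by simp
  ultimately have eq: "integral {0..1} (\<lambda>x. y2 x * z x) = integral {0..1} (\<lambda>x. z2 x * y x)"
    by (simp add: mult.commute[of "y1 _"] eq_neg_iff_add_eq_0[symmetric])
  have qyz: "(\<lambda>x. of_real (q x) * (y x * z x)) integrable_on {0..1}"
    by (intro absolutely_integrable_integrable absolutely_integrable_mult_continuous absolutely_integrable_of_real q continuous_intros Y Z)
  have yz: "(\<lambda>x. y2 x * z x) integrable_on {0..1}" "(\<lambda>x. z2 x * y x) integrable_on {0..1}"
    by (intro absolutely_integrable_integrable absolutely_integrable_mult_continuous Y Z)+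
  have "integral {0..1} (\<lambda>x. f x * z x) = integral {0..1} (\<lambda>x. of_real (q x) * (y x * z x) - y2 x * z x)"
    by (rule integral_spike[OF Y(8)]) (simp only: Y(9)[rule_format], simp add: algebra_simps)
  also have "\<dots> = integral {0..1} (\<lambda>x. of_real (q x) * (y x * z x) - z2 x * y x)"
    using eq by (simp add: integral_diff qyz yz)
  also have "\<dots> = integral {0..1} (\<lambda>x. y x * g x)"
    by (rule integral_spike[OF Z(8), symmetric]) (simp only: Z(9)[rule_format], simp add: algebra_simps)
  finally show ?thesis .
qed

section \<open>Variation of constants for eigenfunctions\<close>

lemma cis_primitive: "((\<lambda>t. \<i> * c * cis (c * t)) has_integral cis (c * x) - 1) {0..x}" if "0 \<le> x" for c x :: real
  using fundamental_theorem_of_calculus[OF that has_vector_derivative_cis, of c] by simp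

text \<open>
  The product of \<open>y' - \<i> c y\<close> with \<open>cis (c x)\<close> has the derivative \<open>(y'' + c\<^sup>2 y) cis (c x)\<close>. The values \<open>c = \<plusminus> \<omega>\<close>
  recover both amplitudes of \<open>y\<close>.
\<close>

lemma variation_of_constants:
  fixes y y1 y2 :: "real \<Rightarrow> complex" and c :: real
  assumes y: "continuous_on {0..1} y" and y1: "continuous_on {0..1} y1" and y2: "y2 absolutely_integrable_on {0..1}"
    and yI: "\<And>x. x \<in> {0..1} \<Longrightarrow> y x = y 0 + integral {0..x} y1"
    and y1I: "\<And>x. x \<in> {0..1} \<Longrightarrow> y1 x = y1 0 + integral {0..x} y2"
    and x: "x \<in> {0..1}"
  shows "(y1 x - \<i> * c * y x) * cis (c * x) = y1 0 - \<i> * c * y 0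
     + integral {0..x} (\<lambda>t. (y2 t + of_real (c\<^sup>2) * y t) * cis (c * t))"
proof -
  let ?E = "\<lambda>t. cis (c * t)" and ?E' = "\<lambda>t. \<i> * c * cis (c * t)"
  have c: "continuous_on S ?E" "continuous_on S ?E'" for S by (intro continuous_intros)+
  have sub: "{0..x} \<subseteq> {0..1}" using x by auto
  have A: "y2 absolutely_integrable_on {0..x}" "y1 absolutely_integrable_on {0..x}"
    "?E' absolutely_integrable_on {0..x}" "y absolutely_integrable_on {0..x}"
    using absolutely_integrable_initial_segment[OF y2 x] continuous_on_subset[OF y sub] continuous_on_subset[OF y1 sub] c
    by (auto intro: absolutely_integrable_continuous_real)
  have E: "?E t = ?E 0 + integral {0..t} ?E'" if "t \<in> {0..x}" for t
    using integral_unique[OF cis_primitive[of t c]] that by simp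
  have x0: "0 \<le> x" using x by simp
  have 1: "integral {0..x} (\<lambda>t. y2 t * ?E t) + integral {0..x} (\<lambda>t. ?E' t * y1 t) = y1 x * ?E x - y1 0"
    using integration_by_parts_AC[OF x0 A(1,3) y1I E] x by simp
  have 2: "integral {0..x} (\<lambda>t. y1 t * ?E t) + integral {0..x} (\<lambda>t. ?E' t * y t) = y x * ?E x - y 0"
    using integration_by_parts_AC[OF x0 A(2,3) yI E] x by simp
  have 3: "integral {0..x} (\<lambda>t. ?E' t * w t) = \<i> * c * integral {0..x} (\<lambda>t. w t * ?E t)" for w
  proof -
    have "(\<lambda>t. ?E' t * w t) = (\<lambda>t. \<i> * c * (w t * ?E t))" by (simp add: fun_eq_iff)
    then show ?thesis by (simp only: integral_mult_right)
  qed
  have i: "(\<lambda>t. y2 t * ?E t) integrable_on {0..x}" "(\<lambda>t. y t * ?E t) integrable_on {0..x}"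
    by (intro absolutely_integrable_integrable absolutely_integrable_mult_continuous A c)+
  have "integral {0..x} (\<lambda>t. (y2 t + of_real (c\<^sup>2) * y t) * ?E t)
      = integral {0..x} (\<lambda>t. y2 t * ?E t + of_real (c\<^sup>2) * (y t * ?E t))"
    by (simp add: algebra_simps)
  also have "\<dots> = integral {0..x} (\<lambda>t. y2 t * ?E t) + of_real (c\<^sup>2) * integral {0..x} (\<lambda>t. y t * ?E t)"
    by (simp only: integral_add integral_mult_right integrable_on_mult_right i)
  finally have 4: "integral {0..x} (\<lambda>t. (y2 t + of_real (c\<^sup>2) * y t) * ?E t)
     = integral {0..x} (\<lambda>t. y2 t * ?E t) + of_real (c\<^sup>2) * integral {0..x} (\<lambda>t. y t * ?E t)" .
  define I2 where "I2 = integral {0..x} (\<lambda>t. y2 t * ?E t)"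
  define I1 where "I1 = integral {0..x} (\<lambda>t. y1 t * ?E t)"
  define I0 where "I0 = integral {0..x} (\<lambda>t. y t * ?E t)"
  have e1: "I2 = y1 x * ?E x - y1 0 - \<i> * c * I1" and e2: "I1 = y x * ?E x - y 0 - \<i> * c * I0"
    using 1 2 unfolding 3 I2_def I1_def I0_def by (simp_all add: algebra_simps)
  have "\<i> * c * (\<i> * c * I0) = - (of_real (c\<^sup>2) * I0)" by (simp add: power2_eq_square algebra_simps)
  then show ?thesis
    unfolding 4 I2_def[symmetric] I0_def[symmetric] e1 e2 by (simp add: algebra_simps)
qed

lemma integral_cis_period:
  assumes c: "c \<noteq> 0" "cis c = 1"
  shows "integral {0..1} (\<lambda>t. cis (c * t)) = 0"
proof -
  have "integral {0..1} (\<lambda>t. \<i> * c * cis (c * t)) = cis (c * 1) - 1"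
    by (rule integral_unique[OF cis_primitive]) simp
  then show ?thesis using c by simp
qed

lemma absolutely_integrable_cis: "(\<lambda>t. cis (c * t)) absolutely_integrable_on {a..b}"
  by (intro absolutely_integrable_continuous_real continuous_intros)

lemma norm_integral_cis_le:
  assumes x: "x \<in> {0..1}"
  shows "norm (integral {0..x} (\<lambda>t. cis (c * t))) \<le> 1"
proof -
  have "L1_norm 0 1 (\<lambda>t. cis (c * t)) \<le> 1 * (1 - 0)" by (rule L1_norm_le_const[OF absolutely_integrable_cis]) auto
  then show ?thesis using norm_primitive_le[OF absolutely_integrable_cis x, of c] by simp
qed

lemma fourier_coeff_cis:
  "fourier_coeff q k = integral {0..1} (\<lambda>x. of_real (q x) * cis (- (2 * pi * of_int k) * x))"
  unfolding fourier_coeff_def cis_conv_exp by (simp add: mult_ac)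

lemma fourier_coeff_uminus: "fourier_coeff q (- k) = cnj (fourier_coeff q k)"
  unfolding fourier_coeff_cis integral_cnj by (simp add: cis_cnj)

text \<open>
  Both equations of the resonance system, each with the crude and with the refined error, for an
  eigenfunction at \<open>\<omega>\<^sup>2 + \<delta>\<close>. The number \<open>R\<close> bounds all primitives of \<open>q\<close> modulated with the frequency \<open>2 \<omega>\<close>.
\<close>

lemma eigenfunction_amplitudes:
  fixes q :: "real \<Rightarrow> real" and y :: "real \<Rightarrow> complex" and k :: int and \<delta> :: real
  defines "\<omega> \<equiv> 2 * pi * of_int k"
  assumes q: "q absolutely_integrable_on {0..1}" and q0: "integral {0..1} q = 0" and k: "k \<noteq> 0"
    and eig: "periodic_op q y (\<lambda>x. of_real (\<omega>\<^sup>2 + \<delta>) * y x)"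
    and P: "L1_norm 0 1 (\<lambda>x. of_real (q x)) + \<bar>\<delta>\<bar> \<le> P" and P\<omega>: "2 * P \<le> \<bar>\<omega>\<bar>"
    and R: "\<And>c x. \<bar>c\<bar> = 2 * \<bar>\<omega>\<bar> \<Longrightarrow> x \<in> {0..1} \<Longrightarrow> norm (integral {0..x} (\<lambda>t. of_real (q t) * cis (c * t))) \<le> R"
  obtains a b :: complex where
    "\<And>x. x \<in> {0..1} \<Longrightarrow> norm (y x - (a * cis (\<omega> * x) + b * cis (- \<omega> * x))) \<le> 2 * P * (norm a + norm b) / \<bar>\<omega>\<bar>"
    "norm (b * fourier_coeff q (2 * k) - \<delta> * a) \<le> 2 * P\<^sup>2 * (norm a + norm b) / \<bar>\<omega>\<bar>"
    "norm (a * cnj (fourier_coeff q (2 * k)) - \<delta> * b) \<le> 2 * P\<^sup>2 * (norm a + norm b) / \<bar>\<omega>\<bar>"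
    "norm (b * fourier_coeff q (2 * k) - \<delta> * a) \<le> (norm a + norm b) * (3 * (R + \<bar>\<delta>\<bar>) * P / (2 * \<bar>\<omega>\<bar>) + 2 * P ^ 3 / \<omega>\<^sup>2)"
    "norm (a * cnj (fourier_coeff q (2 * k)) - \<delta> * b) \<le> (norm a + norm b) * (3 * (R + \<bar>\<delta>\<bar>) * P / (2 * \<bar>\<omega>\<bar>) + 2 * P ^ 3 / \<omega>\<^sup>2)"
proof -
  have \<omega>0: "\<omega> \<noteq> 0" using k by (simp add: \<omega>_def)
  obtain y1 y2 N where Y: "continuous_on {0..1} y" "continuous_on {0..1} y1"
    "y2 absolutely_integrable_on {0..1}"
    "\<forall>x\<in>{0..1}. y x = y 0 + integral {0..x} y1"
    "\<forall>x\<in>{0..1}. y1 x = y1 0 + integral {0..x} y2"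
    "y 1 = y 0" "y1 1 = y1 0"
    "negligible N" "\<forall>x\<in>{0..1} - N. of_real (\<omega>\<^sup>2 + \<delta>) * y x = - y2 x + of_real (q x) * y x"
    using periodic_op_data[OF eig] by blast
  define p where "p t = complex_of_real (q t) - complex_of_real \<delta>" for t
  have qA: "(\<lambda>x. complex_of_real (q x)) absolutely_integrable_on {0..1}" by (rule absolutely_integrable_of_real[OF q])
  have cA: "(\<lambda>x::real. - complex_of_real \<delta>) absolutely_integrable_on {0..1}"
    by (intro absolutely_integrable_continuous_real continuous_intros)
  have p: "p absolutely_integrable_on {0..1}"
    using set_integral_add(1)[OF qA cA] by (simp add: p_def[abs_def])
  have pP: "L1_norm 0 1 p \<le> P"
    using L1_norm_triangle[OF qA cA] L1_norm_le_const[OF cA, of "\<bar>\<delta>\<bar>"] P by (simp add: p_def[abs_def])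
  have p_cis: "integral {0..x} (\<lambda>t. p t * cis (c * t)) = integral {0..x} (\<lambda>t. of_real (q t) * cis (c * t))
      - \<delta> * integral {0..x} (\<lambda>t. cis (c * t))" if x: "x \<in> {0..1}" for c x
  proof -
    have i: "(\<lambda>t. of_real (q t) * cis (c * t)) integrable_on {0..x}" "(\<lambda>t. complex_of_real \<delta> * cis (c * t)) integrable_on {0..x}"
      by (intro absolutely_integrable_integrable absolutely_integrable_mult_continuous absolutely_integrable_initial_segment[OF qA x] integrable_on_mult_right absolutely_integrable_cis continuous_intros)+
    have "integral {0..x} (\<lambda>t. p t * cis (c * t)) = integral {0..x} (\<lambda>t. of_real (q t) * cis (c * t) - complex_of_real \<delta> * cis (c * t))"
      by (simp add: p_def left_diff_distrib)
    then show ?thesis by (simp only: integral_diff i integral_mult_right)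
  qed
  have p_int: "integral {0..1} p = - \<delta>"
  proof -
    have "integral {0..1} (\<lambda>x. complex_of_real (q x)) = of_real (integral {0..1} q)"
      using integral_linear[OF set_lebesgue_integral_eq_integral(1)[OF q] bounded_linear_of_real] by (simp add: o_def)
    then have "integral {0..1} (\<lambda>x. complex_of_real (q x)) = 0" using q0 by simp
    then show ?thesis using p_cis[of 1 0] by simp
  qed
  have bound: "norm (integral {0..x} (\<lambda>t. p t * cis (c * t))) \<le> R + \<bar>\<delta>\<bar>" if "\<bar>c\<bar> = 2 * \<bar>\<omega>\<bar>" "x \<in> {0..1}" for c x
  proof -
    have "\<bar>\<delta>\<bar> * norm (integral {0..x} (\<lambda>t. cis (c * t))) \<le> \<bar>\<delta>\<bar> * 1"
      by (intro mult_left_mono norm_integral_cis_le that) simp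
    then show ?thesis unfolding p_cis[OF that(2)]
      using R[OF that] norm_triangle_ineq4[of "integral {0..x} (\<lambda>t. of_real (q t) * cis (c * t))" "\<delta> * integral {0..x} (\<lambda>t. cis (c * t))"]
      by (simp add: norm_mult)
  qed
  have R0: "R \<ge> 0" using R[of "2 * \<omega>" 0] by (simp add: abs_mult)
  have cis1: "cis \<omega> = 1" unfolding \<omega>_def using cis_multiple_2pi[of "of_int k"] by simp
  have cis1': "cis (- \<omega>) = 1" using cis_multiple_2pi[of "of_int (- k)"] by (simp add: \<omega>_def)
  define W0 where "W0 c = y1 0 - \<i> * c * y 0" for c :: real
  define W where "W c x = (y1 x - \<i> * c * y x) * cis (c * x)" for c x :: real
  define J where "J c x = integral {0..x} (\<lambda>t. p t * (y t * cis (c * t)))" for c x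
  have W: "W c x = W0 c + J c x" if c: "c\<^sup>2 = \<omega>\<^sup>2" and x: "x \<in> {0..1}" for c x
  proof -
    have "W c x = W0 c + integral {0..x} (\<lambda>t. (y2 t + of_real (c\<^sup>2) * y t) * cis (c * t))"
      unfolding W_def W0_def by (rule variation_of_constants[OF Y(1,2,3) Y(4)[rule_format] Y(5)[rule_format] x])
    also have "integral {0..x} (\<lambda>t. (y2 t + of_real (c\<^sup>2) * y t) * cis (c * t)) = J c x"
      unfolding J_def
    proof (rule integral_spike[OF Y(8)])
      fix t assume "t \<in> {0..x} - N"
      then have "of_real (\<omega>\<^sup>2 + \<delta>) * y t = - y2 t + of_real (q t) * y t" by (intro Y(9)[rule_format]) (use x in auto)
      then have "p t * y t = y2 t + of_real (c\<^sup>2) * y t" unfolding p_def c by (simp add: algebra_simps)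
      then show "p t * (y t * cis (c * t)) = (y2 t + of_real (c\<^sup>2) * y t) * cis (c * t)"
        by (metis mult.assoc)
    qed
    finally show ?thesis .
  qed
  define A where "A w = W0 (- w) / (2 * \<i> * w)" for w :: real
  define \<alpha> where "\<alpha> w x = W (- w) x / (2 * \<i> * w)" for w x :: real
  \<comment> \<open>both equations at once: \<open>w = \<omega>\<close> gives the first and \<open>w = - \<omega>\<close> the second\<close>
  have claim: "(\<forall>x\<in>{0..1}. norm (y x - (A w * cis (w * x) + A (- w) * cis (- w * x))) \<le> 2 * P * (norm (A w) + norm (A (- w))) / \<bar>\<omega>\<bar>) \<and>
      norm (A (- w) * integral {0..1} (\<lambda>t. p t * cis (- 2 * w * t)) - \<delta> * A w) \<le> 2 * P\<^sup>2 * (norm (A w) + norm (A (- w))) / \<bar>\<omega>\<bar> \<and>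
      norm (A (- w) * integral {0..1} (\<lambda>t. p t * cis (- 2 * w * t)) - \<delta> * A w) \<le> (norm (A w) + norm (A (- w))) * (3 * (R + \<bar>\<delta>\<bar>) * P / (2 * \<bar>\<omega>\<bar>) + 2 * P ^ 3 / \<omega>\<^sup>2)"
    if w: "w = \<omega> \<or> w = - \<omega>" for w
  proof -
    have w0: "w \<noteq> 0" and w2: "w\<^sup>2 = \<omega>\<^sup>2" "(- w)\<^sup>2 = \<omega>\<^sup>2" and wa: "\<bar>w\<bar> = \<bar>\<omega>\<bar>" and wc: "cis (- w) = 1"
      using w \<omega>0 cis1 cis1' by auto
    have y_eq: "y x = \<alpha> w x * cis (w * x) + \<alpha> (- w) x * cis (- w * x)" for x
    proof -
      have "W (- w) x * cis (w * x) = y1 x + \<i> * w * y x" "W w x * cis (- w * x) = y1 x - \<i> * w * y x"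
        by (simp_all add: W_def mult.assoc cis_mult)
      moreover have "\<alpha> w x * cis (w * x) + \<alpha> (- w) x * cis (- w * x)
          = (W (- w) x * cis (w * x) - W w x * cis (- w * x)) / (2 * \<i> * w)"
        by (simp add: \<alpha>_def diff_divide_distrib)
      moreover have "((y1 x + \<i> * w * y x) - (y1 x - \<i> * w * y x)) / (2 * \<i> * w) = y x"
        using w0 by simp
      ultimately show ?thesis by simp
    qed
    have a: "\<alpha> w x = A w + integral {0..x} (\<lambda>t. p t * (y t * cis (- w * t))) / (2 * \<i> * w)" if "x \<in> {0..1}" for x
      using W[OF w2(2) that] by (simp add: \<alpha>_def A_def J_def add_divide_distrib)
    have b: "\<alpha> (- w) x = A (- w) - integral {0..x} (\<lambda>t. p t * (y t * cis (w * t))) / (2 * \<i> * w)" if "x \<in> {0..1}" for x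
      using W[OF w2(1) that] by (simp add: \<alpha>_def A_def J_def add_divide_distrib)
    have zero: "integral {0..1} (\<lambda>t. p t * (y t * cis (- w * t))) = 0"
      using W[OF w2(2), of 1] Y(6,7) wc by (simp add: W_def W0_def J_def)
    note hyps = p pP P\<omega>[folded wa] w0 Y(1) y_eq a b
    have b1: "norm (integral {0..x} (\<lambda>t. p t * cis (- 2 * w * t))) \<le> R + \<bar>\<delta>\<bar>"
      and b2: "norm (integral {0..x} (\<lambda>t. p t * cis (2 * w * t))) \<le> R + \<bar>\<delta>\<bar>" if "x \<in> {0..1}" for x
      by (rule bound[OF _ that]; simp add: wa abs_mult)+
    have b0: "norm (integral {0..1} p) \<le> R + \<bar>\<delta>\<bar>" unfolding p_int using R0 by simp
    have "norm (y x - (A w * cis (w * x) + A (- w) * cis (- w * x))) \<le> 2 * P * (norm (A w) + norm (A (- w))) / \<bar>w\<bar>"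
      if "x \<in> {0..1}" for x
      by (rule solution_approx[OF hyps that])
    moreover have "norm (A w * integral {0..1} p + A (- w) * integral {0..1} (\<lambda>t. p t * cis (- 2 * w * t))) \<le> 2 * P\<^sup>2 * (norm (A w) + norm (A (- w))) / \<bar>w\<bar>"
      by (rule resonance_first_order[OF hyps zero])
    moreover have "norm (A w * integral {0..1} p + A (- w) * integral {0..1} (\<lambda>t. p t * cis (- 2 * w * t))) \<le> (norm (A w) + norm (A (- w))) * (3 * (R + \<bar>\<delta>\<bar>) * P / (2 * \<bar>w\<bar>) + 2 * P ^ 3 / w\<^sup>2)"
      by (rule resonance_second_order[OF hyps zero b0 b1 b2])
    moreover have "A w * integral {0..1} p + A (- w) * integral {0..1} (\<lambda>t. p t * cis (- 2 * w * t))
        = A (- w) * integral {0..1} (\<lambda>t. p t * cis (- 2 * w * t)) - \<delta> * A w"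
      by (simp add: p_int)
    ultimately show ?thesis unfolding wa w2 by simp
  qed
  have F: "integral {0..1} (\<lambda>t. p t * cis (- 2 * w * t)) = fourier_coeff q (2 * m)"
    if "w = 2 * pi * of_int m" "m \<noteq> 0" for w and m :: int
  proof -
    have "cis (- 2 * w) = 1" using cis_multiple_2pi[of "of_int (- 2 * m)"] that by (simp add: mult_ac)
    then have "integral {0..1} (\<lambda>t. cis (- 2 * w * t)) = 0" using that by (intro integral_cis_period) auto
    then show ?thesis unfolding fourier_coeff_cis using p_cis[of 1 "- 2 * w"] that by (simp add: mult_ac)
  qed
  have F1: "integral {0..1} (\<lambda>t. p t * cis (- 2 * \<omega> * t)) = fourier_coeff q (2 * k)"
    by (rule F) (simp_all add: \<omega>_def k)
  have F2: "integral {0..1} (\<lambda>t. p t * cis (- 2 * - \<omega> * t)) = cnj (fourier_coeff q (2 * k))"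
    using F[of "- \<omega>" "- k"] fourier_coeff_uminus[of q "2 * k"] k by (simp add: \<omega>_def)
  show ?thesis
  proof (rule that[of "A \<omega>" "A (- \<omega>)"])
    note c1 = claim[of \<omega>, unfolded F1, simplified] and c2 = claim[of "- \<omega>", unfolded F2, simplified]
    show "norm (y x - (A \<omega> * cis (\<omega> * x) + A (- \<omega>) * cis (- \<omega> * x))) \<le> 2 * P * (norm (A \<omega>) + norm (A (- \<omega>))) / \<bar>\<omega>\<bar>"
      if "x \<in> {0..1}" for x using c1 that by simp
    show "norm (A (- \<omega>) * fourier_coeff q (2 * k) - \<delta> * A \<omega>) \<le> 2 * P\<^sup>2 * (norm (A \<omega>) + norm (A (- \<omega>))) / \<bar>\<omega>\<bar>"
      "norm (A (- \<omega>) * fourier_coeff q (2 * k) - \<delta> * A \<omega>) \<le> (norm (A \<omega>) + norm (A (- \<omega>))) * (3 * (R + \<bar>\<delta>\<bar>) * P / (2 * \<bar>\<omega>\<bar>) + 2 * P ^ 3 / \<omega>\<^sup>2)"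
      using c1 by simp_all
    show "norm (A \<omega> * cnj (fourier_coeff q (2 * k)) - \<delta> * A (- \<omega>)) \<le> 2 * P\<^sup>2 * (norm (A \<omega>) + norm (A (- \<omega>))) / \<bar>\<omega>\<bar>"
      "norm (A \<omega> * cnj (fourier_coeff q (2 * k)) - \<delta> * A (- \<omega>)) \<le> (norm (A \<omega>) + norm (A (- \<omega>))) * (3 * (R + \<bar>\<delta>\<bar>) * P / (2 * \<bar>\<omega>\<bar>) + 2 * P ^ 3 / \<omega>\<^sup>2)"
      using c2 by (simp_all add: add.commute)
  qed
qed

section \<open>The two-by-two resonance system\<close>

text \<open>
  Take absolute values in both equations and add: \<open>(\<bar>z\<bar> - \<bar>\<delta>\<bar>) (\<bar>a\<bar> + \<bar>b\<bar>)\<close> is bounded by the sum of the errors.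
  In terms of matrices, the system is nearly singular, so \<open>\<delta>\<close> is close to an eigenvalue \<open>\<plusminus> \<bar>z\<bar>\<close>.
\<close>

lemma resonance_splitting:
  fixes a b z :: complex and \<delta> \<eta> :: real
  assumes s: "norm a + norm b > 0"
    and 1: "norm (b * z - \<delta> * a) \<le> \<eta> * (norm a + norm b)"
    and 2: "norm (a * cnj z - \<delta> * b) \<le> \<eta> * (norm a + norm b)"
  shows "\<bar>\<bar>\<delta>\<bar> - norm z\<bar> \<le> 2 * \<eta>"
proof -
  let ?s = "norm a + norm b"
  have "\<bar>norm b * norm z - \<bar>\<delta>\<bar> * norm a\<bar> \<le> \<eta> * ?s"
    using 1 norm_triangle_ineq3[of "b * z" "\<delta> * a"] by (simp add: norm_mult)
  moreover have "\<bar>norm a * norm z - \<bar>\<delta>\<bar> * norm b\<bar> \<le> \<eta> * ?s"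
    using 2 norm_triangle_ineq3[of "a * cnj z" "\<delta> * b"] by (simp add: norm_mult)
  ultimately have "\<bar>(norm b * norm z - \<bar>\<delta>\<bar> * norm a) + (norm a * norm z - \<bar>\<delta>\<bar> * norm b)\<bar> \<le> 2 * \<eta> * ?s" by linarith
  also have "(norm b * norm z - \<bar>\<delta>\<bar> * norm a) + (norm a * norm z - \<bar>\<delta>\<bar> * norm b) = (norm z - \<bar>\<delta>\<bar>) * ?s"
    by (simp add: algebra_simps)
  finally have "\<bar>norm z - \<bar>\<delta>\<bar>\<bar> * ?s \<le> 2 * \<eta> * ?s" using s by (simp add: abs_mult)
  then have "\<bar>norm z - \<bar>\<delta>\<bar>\<bar> \<le> 2 * \<eta>" using s by (meson mult_le_cancel_right_pos)
  then show ?thesis by (simp add: abs_minus_commute)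
qed

text \<open>
  The vector \<open>(a, b)\<close> is close to the eigenvector \<open>(sgn \<delta> * sgn z, 1)\<close> of the resonance matrix for
  the eigenvalue \<open>sgn \<delta> * \<bar>z\<bar>\<close>, as the error \<open>\<eta>\<close> is small compared with the gap between the two eigenvalues.
\<close>

lemma resonance_direction:
  fixes a b z :: complex and \<delta> \<eta> :: real
  assumes s: "norm a + norm b > 0"
    and 1: "norm (b * z - \<delta> * a) \<le> \<eta> * (norm a + norm b)"
    and 2: "norm (a * cnj z - \<delta> * b) \<le> \<eta> * (norm a + norm b)"
    and z: "30 * \<eta> \<le> norm z" "z \<noteq> 0" and \<delta>: "\<delta> \<noteq> 0"
  shows "norm (a - sgn \<delta> * sgn z * b) \<le> (norm a + norm b) / 10"
proof -
  let ?s = "norm a + norm b" and ?u = "complex_of_real (sgn \<delta>) * sgn z"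
  have \<eta>: "\<eta> \<ge> 0"
  proof (rule ccontr)
    assume "\<not> \<eta> \<ge> 0"
    then have "\<eta> * ?s < 0" using s by (simp add: mult_neg_pos)
    then show False using 1 norm_ge_zero[of "b * z - \<delta> * a"] by linarith
  qed
  have zs: "norm z * sgn z = z" using z(2) by (simp add: sgn_div_norm scaleR_conv_of_real)
  have "norm z * norm (a - ?u * b) = norm (sgn \<delta> * (norm z * a) - z * b)"
  proof -
    have "norm z * norm (a - ?u * b) = norm (sgn \<delta> * (norm z * (a - ?u * b)))"
      using \<delta> by (simp add: norm_mult)
    also have "sgn \<delta> * (norm z * (a - ?u * b)) = sgn \<delta> * (norm z * a) - (complex_of_real (sgn \<delta>) * complex_of_real (sgn \<delta>)) * ((norm z * sgn z) * b)"
      by (simp only: right_diff_distrib ac_simps)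
    also have "\<dots> = sgn \<delta> * (norm z * a) - z * b"
    proof -
      have "complex_of_real (sgn \<delta>) * complex_of_real (sgn \<delta>) = 1"
        using \<delta> by (simp add: sgn_if)
      then show ?thesis unfolding zs by simp
    qed
    finally show ?thesis .
  qed
  also have "\<dots> = norm ((b * z - \<delta> * a) + of_real (sgn \<delta> * (\<bar>\<delta>\<bar> - norm z)) * a)"
  proof -
    have "\<delta> = sgn \<delta> * \<bar>\<delta>\<bar>" by (simp add: sgn_mult_abs)
    then have "complex_of_real \<delta> = of_real (sgn \<delta>) * of_real \<bar>\<delta>\<bar>" by (metis of_real_mult)
    then have "- (sgn \<delta> * (norm z * a) - z * b) = (b * z - \<delta> * a) + of_real (sgn \<delta> * (\<bar>\<delta>\<bar> - norm z)) * a"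
      by (simp add: algebra_simps)
    then show ?thesis by (metis norm_minus_cancel)
  qed
  also have "\<dots> \<le> \<eta> * ?s + 2 * \<eta> * ?s"
  proof (rule norm_triangle_mono[OF 1])
    have "norm (of_real (sgn \<delta> * (\<bar>\<delta>\<bar> - norm z)) * a) = \<bar>\<bar>\<delta>\<bar> - norm z\<bar> * norm a"
      using \<delta> by (simp only: norm_mult norm_of_real abs_mult abs_sgn_eq) simp
    also have "\<dots> \<le> (2 * \<eta>) * ?s"
      using \<eta> by (intro mult_mono resonance_splitting[OF s 1 2]) auto
    finally show "norm (of_real (sgn \<delta> * (\<bar>\<delta>\<bar> - norm z)) * a) \<le> 2 * \<eta> * ?s" .
  qed
  also have "\<dots> = 30 * \<eta> * (?s / 10)" by simp
  also have "\<dots> \<le> norm z * (?s / 10)" using z(1) s by (intro mult_right_mono) auto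
  finally show ?thesis using z(2) by simp
qed

text \<open>
  For vectors exactly parallel to \<open>(u, 1)\<close> the inner product is \<open>2 * b1 * cnj b2\<close>, of modulus half the
  product of the two sums; the constant \<open>1/5\<close> leaves room for the deviations.
\<close>

lemma inner_aligned:
  fixes a1 b1 a2 b2 u :: complex
  assumes u: "norm u = 1"
    and 1: "norm (a1 - u * b1) \<le> (norm a1 + norm b1) / 10"
    and 2: "norm (a2 - u * b2) \<le> (norm a2 + norm b2) / 10"
  shows "(norm a1 + norm b1) * (norm a2 + norm b2) / 5 \<le> norm (a1 * cnj a2 + b1 * cnj b2)"
proof -
  define s1 s2 where "s1 = norm a1 + norm b1" and "s2 = norm a2 + norm b2"
  have s: "s1 \<ge> 0" "s2 \<ge> 0" "norm a2 \<le> s2" "norm b1 \<le> s1" by (auto simp: s1_def s2_def)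
  have b1: "9 / 20 * s1 \<le> norm b1"
    using 1 norm_triangle_ineq2[of a1 "u * b1"] u by (simp add: s1_def norm_mult)
  have b2: "9 / 20 * s2 \<le> norm b2"
    using 2 norm_triangle_ineq2[of a2 "u * b2"] u by (simp add: s2_def norm_mult)
  have uu: "u * cnj u = 1" using u by (simp add: complex_norm_square[symmetric])
  have "2 * (b1 * cnj b2) = (a1 * cnj a2 + b1 * cnj b2) - ((a1 - u * b1) * cnj a2 + u * b1 * cnj (a2 - u * b2))"
  proof -
    have "(a1 - u * b1) * cnj a2 + u * b1 * cnj (a2 - u * b2) = a1 * cnj a2 - (u * cnj u) * (b1 * cnj b2)"
      by (simp add: algebra_simps)
    then show ?thesis unfolding uu by simp
  qed
  then have "2 * (norm b1 * norm b2) = norm ((a1 * cnj a2 + b1 * cnj b2) - ((a1 - u * b1) * cnj a2 + u * b1 * cnj (a2 - u * b2)))"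
    by (metis complex_mod_cnj norm_mult norm_numeral)
  also have "\<dots> \<le> norm (a1 * cnj a2 + b1 * cnj b2) + norm ((a1 - u * b1) * cnj a2 + u * b1 * cnj (a2 - u * b2))"
    by (rule norm_triangle_ineq4)
  also have "norm ((a1 - u * b1) * cnj a2 + u * b1 * cnj (a2 - u * b2)) \<le> s1 / 10 * s2 + s1 * (s2 / 10)"
  proof (rule norm_triangle_mono)
    show "norm ((a1 - u * b1) * cnj a2) \<le> s1 / 10 * s2"
      unfolding norm_mult complex_mod_cnj using 1 s by (intro mult_mono) (auto simp: s1_def)
    show "norm (u * b1 * cnj (a2 - u * b2)) \<le> s1 * (s2 / 10)"
      unfolding norm_mult complex_mod_cnj u using 2 s by (intro mult_mono) (auto simp: s2_def)
  qed
  finally have "2 * (norm b1 * norm b2) \<le> norm (a1 * cnj a2 + b1 * cnj b2) + s1 * s2 / 5" by simp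
  moreover have "(9 / 20 * s1) * (9 / 20 * s2) \<le> norm b1 * norm b2"
    using b1 b2 s by (intro mult_mono) auto
  moreover have "s1 * s2 \<ge> 0" using s by simp
  ultimately have "s1 * s2 / 5 \<le> norm (a1 * cnj a2 + b1 * cnj b2)" by simp
  then show ?thesis by (simp add: s1_def s2_def)
qed

text \<open>
  As \<open>cis (\<omega> x)\<close> and \<open>cis (- \<omega> x)\<close> are orthonormal on the period, the inner product of the leading parts is
  that of the coefficient vectors; the deviation of \<open>y1\<close> and \<open>y2\<close> from them changes it by little more than half of the
  lower bound in \<open>inner_aligned\<close>.
\<close>

lemma aligned_not_orthogonal:
  fixes y1 y2 :: "real \<Rightarrow> complex"
  assumes \<omega>: "\<omega> \<noteq> 0" "cis \<omega> = 1"
    and y: "continuous_on {0..1} y1" "continuous_on {0..1} y2"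
    and s1: "norm a1 + norm b1 > 0" and s2: "norm a2 + norm b2 > 0"
    and u: "norm u = 1"
    and 1: "norm (a1 - u * b1) \<le> (norm a1 + norm b1) / 10"
    and 2: "norm (a2 - u * b2) \<le> (norm a2 + norm b2) / 10"
    and y1: "\<And>x. x \<in> {0..1} \<Longrightarrow> norm (y1 x - (a1 * cis (\<omega> * x) + b1 * cis (- \<omega> * x))) \<le> (norm a1 + norm b1) / 20"
    and y2: "\<And>x. x \<in> {0..1} \<Longrightarrow> norm (y2 x - (a2 * cis (\<omega> * x) + b2 * cis (- \<omega> * x))) \<le> (norm a2 + norm b2) / 20"
  shows "integral {0..1} (\<lambda>x. y1 x * cnj (y2 x)) \<noteq> 0"
proof
  assume 0: "integral {0..1} (\<lambda>x. y1 x * cnj (y2 x)) = 0"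
  define s1 s2 where "s1 = norm a1 + norm b1" and "s2 = norm a2 + norm b2"
  have s: "s1 > 0" "s2 > 0" using assms by (auto simp: s1_def s2_def)
  define w1 w2 where "w1 x = a1 * cis (\<omega> * x) + b1 * cis (- \<omega> * x)" and "w2 x = a2 * cis (\<omega> * x) + b2 * cis (- \<omega> * x)" for x
  have w: "continuous_on {0..1} w1" "continuous_on {0..1} w2"
    unfolding w1_def w2_def by (intro continuous_intros)+
  have w1n: "norm (w1 x) \<le> s1" and w2n: "norm (w2 x) \<le> s2" for x
    unfolding w1_def w2_def s1_def s2_def by (intro norm_triangle_mono; simp add: norm_mult)+
  let ?d = "\<lambda>x. y1 x * cnj (y2 x) - w1 x * cnj (w2 x)"
  have dn: "norm (?d x) \<le> s1 * s2 * (41 / 400)" if x: "x \<in> {0..1}" for x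
  proof -
    have r1: "norm (y1 x - w1 x) \<le> s1 / 20" and r2: "norm (y2 x - w2 x) \<le> s2 / 20"
      using y1[OF x] y2[OF x] by (simp_all add: w1_def w2_def s1_def s2_def)
    have y2n: "norm (y2 x) \<le> 21 / 20 * s2"
      using r2 w2n[of x] norm_triangle_ineq2[of "y2 x" "w2 x"] by simp
    have "?d x = (y1 x - w1 x) * cnj (y2 x) + w1 x * cnj (y2 x - w2 x)" by (simp add: algebra_simps)
    also have "norm \<dots> \<le> s1 / 20 * (21 / 20 * s2) + s1 * (s2 / 20)"
    proof (rule norm_triangle_mono)
      show "norm ((y1 x - w1 x) * cnj (y2 x)) \<le> s1 / 20 * (21 / 20 * s2)"
        unfolding norm_mult complex_mod_cnj using r1 y2n s by (intro mult_mono) auto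
      show "norm (w1 x * cnj (y2 x - w2 x)) \<le> s1 * (s2 / 20)"
        unfolding norm_mult complex_mod_cnj using r2 w1n[of x] s by (intro mult_mono) auto
    qed
    finally show ?thesis by (simp add: field_simps)
  qed
  have ww: "integral {0..1} (\<lambda>x. w1 x * cnj (w2 x)) = a1 * cnj a2 + b1 * cnj b2"
  proof -
    have c: "cis (2 * \<omega>) = 1" "cis (- 2 * \<omega>) = 1"
      using \<omega>(2) cis_mult[of \<omega> \<omega>] cis_mult[of "-\<omega>" "-\<omega>"] by (simp_all add: cis_inverse[symmetric] flip: cis_cnj) 
    have i: "((\<lambda>x. cis (2 * \<omega> * x)) has_integral 0) {0..1}" "((\<lambda>x. cis (- 2 * \<omega> * x)) has_integral 0) {0..1}"
      using integrable_integral[OF absolutely_integrable_integrable[OF absolutely_integrable_cis], of "2 * \<omega>" 0 1] integrable_integral[OF absolutely_integrable_integrable[OF absolutely_integrable_cis], of "- 2 * \<omega>" 0 1]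
        integral_cis_period[OF _ c(1)] integral_cis_period[OF _ c(2)] \<omega>(1) by simp_all
    have "((\<lambda>x. (a1 * cnj a2 + b1 * cnj b2) + (a1 * cnj b2 * cis (2 * \<omega> * x) + b1 * cnj a2 * cis (- 2 * \<omega> * x)))
        has_integral ((1 - 0) *\<^sub>R (a1 * cnj a2 + b1 * cnj b2) + (a1 * cnj b2 * 0 + b1 * cnj a2 * 0))) {0..1}"
      using has_integral_const_real[of "a1 * cnj a2 + b1 * cnj b2" 0 1]
      by (intro has_integral_add has_integral_mult_right i) simp
    moreover have "w1 x * cnj (w2 x) = (a1 * cnj a2 + b1 * cnj b2) + (a1 * cnj b2 * cis (2 * \<omega> * x) + b1 * cnj a2 * cis (- 2 * \<omega> * x))" for x
    proof -
      have "cis (2 * \<omega> * x) = cis (\<omega> * x) * cis (\<omega> * x)" "cis (- 2 * \<omega> * x) = cis (- \<omega> * x) * cis (- \<omega> * x)"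
        "cis (\<omega> * x) * cis (- \<omega> * x) = 1" by (simp_all add: cis_mult mult.assoc)
      moreover have "cnj (w2 x) = cnj a2 * cis (- \<omega> * x) + cnj b2 * cis (\<omega> * x)" by (simp add: w2_def cis_cnj)
      ultimately show ?thesis unfolding w1_def by algebra
    qed
    ultimately show ?thesis by (simp add: integral_unique)
  qed
  have dc: "continuous_on {0..1} ?d" by (intro continuous_intros y w)
  have "norm (integral {0..1} ?d) \<le> L1_norm 0 1 ?d"
    by (rule norm_integral_le_L1_norm[OF absolutely_integrable_continuous_real[OF dc]])
  also have "\<dots> \<le> s1 * s2 * (41 / 400) * (1 - 0)"
    by (rule L1_norm_le_const[OF absolutely_integrable_continuous_real[OF dc] _ dn]) auto
  also have "integral {0..1} ?d = - (a1 * cnj a2 + b1 * cnj b2)"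
  proof -
    have "integral {0..1} ?d = integral {0..1} (\<lambda>x. y1 x * cnj (y2 x)) - integral {0..1} (\<lambda>x. w1 x * cnj (w2 x))"
      by (intro integral_diff integrable_continuous_real continuous_intros y w)
    then show ?thesis using 0 ww by simp
  qed
  finally have "norm (a1 * cnj a2 + b1 * cnj b2) \<le> s1 * s2 * (41 / 400)"
    by (simp only: norm_minus_cancel diff_zero mult_1_right)
  moreover have "s1 * s2 / 5 \<le> norm (a1 * cnj a2 + b1 * cnj b2)"
    using inner_aligned[OF u 1 2] by (simp add: s1_def s2_def)
  moreover have "s1 * s2 > 0" using s by simp
  ultimately show False by simp
qed

section \<open>Asymptotics of eigenfunctions\<close>

text \<open>
  The bootstrap for \<open>\<delta>\<close>. From \<open>\<delta> = O(\<surd>n)\<close> the crude error is \<open>O(1)\<close>, so \<open>\<delta>\<close> is bounded; with \<open>\<delta>\<close> bounded the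
  crude error is \<open>O(1/n)\<close>, so \<open>\<delta>\<close> tends to zero together with \<open>q\<^sub>2\<^sub>n\<close>; with both small the refined error is below
  \<open>e/n\<close>. The bounds depend on \<open>\<delta>\<close> only through \<open>C\<close>, so the threshold for \<open>n\<close> serves all eigenfunctions.
\<close>

lemma eigenfunction_asymptotics:
  fixes q :: "real \<Rightarrow> real" and C e :: real
  assumes q: "q absolutely_integrable_on {0..1}" and q0: "integral {0..1} q = 0" and C: "C \<ge> 0" and e: "e > 0"
  shows "\<forall>\<^sub>F n in sequentially. \<forall>\<delta> y. \<bar>\<delta>\<bar> \<le> C * sqrt (real n) \<longrightarrow>
      periodic_op q y (\<lambda>x. of_real ((2 * pi * real n)\<^sup>2 + \<delta>) * y x) \<longrightarrow> y \<noteq> (\<lambda>x. 0) \<longrightarrow>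
      (\<exists>(a::complex) (b::complex). 0 < norm a + norm b \<and>
        norm (b * fourier_coeff q (2 * int n) - of_real \<delta> * a) \<le> e / real n * (norm a + norm b) \<and>
        norm (a * cnj (fourier_coeff q (2 * int n)) - of_real \<delta> * b) \<le> e / real n * (norm a + norm b) \<and>
        (\<forall>x\<in>{0..1}. norm (y x - (a * cis (2 * pi * real n * x) + b * cis (- (2 * pi * real n) * x))) \<le> e * (norm a + norm b)))"
proof -
  let ?q = "\<lambda>x. complex_of_real (q x)"
  define Q where "Q = L1_norm 0 1 ?q"
  have Q: "Q \<ge> 0" unfolding Q_def by (rule L1_norm_nonneg)
  \<comment> \<open>the summand in parentheses bounds \<open>\<bar>\<delta>\<bar>\<close> after the first step of the bootstrap\<close>
  define P where "P = Q + (Q + 4 * (Q + C)\<^sup>2)"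
  have P: "P \<ge> 0" unfolding P_def using Q by simp
  \<comment> \<open>\<open>r\<close> will bound \<open>\<bar>\<delta>\<bar>\<close>; its size is dictated by the refined error\<close>
  define r where "r = e / (12 * (P + 1))"
  have r: "r > 0" unfolding r_def using e P by simp
  have rP: "6 * r * P \<le> e / 2"
    unfolding r_def using e P by (simp add: field_simps)
  obtain C0 where C0: "\<And>c x. \<bar>c\<bar> \<ge> C0 \<Longrightarrow> x \<in> {0..1} \<Longrightarrow> norm (integral {0..x} (\<lambda>t. ?q t * cis (c * t))) \<le> r / 2"
    using Riemann_Lebesgue_uniform[OF absolutely_integrable_of_real[OF q] zero_le_one half_gt_zero[OF r]] by metis
  have large: "\<forall>\<^sub>F n in sequentially. K \<le> real n" for K
    using eventually_compose_filterlim[OF eventually_ge_at_top filterlim_real_sequentially] .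
  show ?thesis
    using large[of 1] large[of "(2 * (Q + C))\<^sup>2"] large[of "2 * P"] large[of C0] large[of "8 * P\<^sup>2 / r"]
      large[of "4 * P ^ 3 / e"] large[of "2 * P / e"]
  proof eventually_elim
    case (elim n)
    define \<omega> where "\<omega> = 2 * pi * real n"
    have n: "real n > 0" using elim(1) by simp
    have \<omega>n: "real n \<le> \<omega>" "\<omega> > 0"
    proof -
      have "1 * real n \<le> (2 * pi) * real n" using pi_gt3 n by (intro mult_right_mono) auto
      then show "real n \<le> \<omega>" by (simp add: \<omega>_def)
      then show "\<omega> > 0" using n by linarith
    qed
    let ?z = "fourier_coeff q (2 * int n)"
    have R: "norm (integral {0..x} (\<lambda>t. ?q t * cis (c * t))) \<le> r / 2" if "\<bar>c\<bar> = 2 * \<bar>\<omega>\<bar>" "x \<in> {0..1}" for c x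
      by (rule C0) (use that \<omega>n elim(4) in auto)
    have z: "norm ?z \<le> r / 2"
      using R[of "- (2 * pi * of_int (2 * int n))" 1] by (simp add: fourier_coeff_cis \<omega>_def abs_mult)
    have zQ: "norm ?z \<le> Q"
      using norm_integral_mult_le[OF absolutely_integrable_of_real[OF q], of "\<lambda>x. cis (- (2 * pi * of_int (2 * int n)) * x)" 1]
      by (simp add: fourier_coeff_cis Q_def continuous_intros)
    show ?case
    proof (intro allI impI)
      fix \<delta> y assume \<delta>: "\<bar>\<delta>\<bar> \<le> C * sqrt (real n)"
        and eig: "periodic_op q y (\<lambda>x. of_real ((2 * pi * real n)\<^sup>2 + \<delta>) * y x)" and y0: "y \<noteq> (\<lambda>x. 0)"
      obtain x0 where x0: "x0 \<in> {0..1}" "y x0 \<noteq> 0"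
        using periodic_op_data[OF eig] y0 by (metis ext)
      have amp: "\<exists>(a::complex) (b::complex). 0 < norm a + norm b \<and>
        (\<forall>x\<in>{0..1}. norm (y x - (a * cis (\<omega> * x) + b * cis (- \<omega> * x))) \<le> 2 * p * (norm a + norm b) / \<omega>) \<and>
        norm (b * ?z - \<delta> * a) \<le> 2 * p\<^sup>2 / \<omega> * (norm a + norm b) \<and>
        norm (a * cnj ?z - \<delta> * b) \<le> 2 * p\<^sup>2 / \<omega> * (norm a + norm b) \<and>
        norm (b * ?z - \<delta> * a) \<le> (3 * (r / 2 + \<bar>\<delta>\<bar>) * p / (2 * \<omega>) + 2 * p ^ 3 / \<omega>\<^sup>2) * (norm a + norm b) \<and>
        norm (a * cnj ?z - \<delta> * b) \<le> (3 * (r / 2 + \<bar>\<delta>\<bar>) * p / (2 * \<omega>) + 2 * p ^ 3 / \<omega>\<^sup>2) * (norm a + norm b)"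
        if p: "Q + \<bar>\<delta>\<bar> \<le> p" "2 * p \<le> \<omega>" for p
      proof -
        have w: "2 * pi * of_int (int n) = \<omega>" by (simp add: \<omega>_def)
        obtain a b :: complex where ab:
          "\<And>x. x \<in> {0..1} \<Longrightarrow> norm (y x - (a * cis (\<omega> * x) + b * cis (- \<omega> * x))) \<le> 2 * p * (norm a + norm b) / \<bar>\<omega>\<bar>"
          "norm (b * ?z - \<delta> * a) \<le> 2 * p\<^sup>2 * (norm a + norm b) / \<bar>\<omega>\<bar>"
          "norm (a * cnj ?z - \<delta> * b) \<le> 2 * p\<^sup>2 * (norm a + norm b) / \<bar>\<omega>\<bar>"
          "norm (b * ?z - \<delta> * a) \<le> (norm a + norm b) * (3 * (r / 2 + \<bar>\<delta>\<bar>) * p / (2 * \<bar>\<omega>\<bar>) + 2 * p ^ 3 / \<omega>\<^sup>2)"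
          "norm (a * cnj ?z - \<delta> * b) \<le> (norm a + norm b) * (3 * (r / 2 + \<bar>\<delta>\<bar>) * p / (2 * \<bar>\<omega>\<bar>) + 2 * p ^ 3 / \<omega>\<^sup>2)"
          using eigenfunction_amplitudes[OF q q0, of "int n" y \<delta> p "r / 2", unfolded w] n eig p R \<omega>n
          unfolding Q_def \<omega>_def[symmetric] by auto
        have "0 < norm a + norm b"
        proof (rule ccontr)
          assume "\<not> ?thesis"
          then have "norm a + norm b = 0" "a = 0" "b = 0" using norm_ge_zero[of a] norm_ge_zero[of b] by (smt (verit) norm_eq_zero)+
          then show False using ab(1)[OF x0(1)] x0(2) by simp
        qed
        then show ?thesis using ab \<omega>n by (intro exI[of _ a] exI[of _ b]) (simp add: mult.commute)
      qed
      have \<delta>P: "Q + \<bar>\<delta>\<bar> \<le> P"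
      proof -
        \<comment> \<open>first step of the bootstrap, with the a priori bound for \<open>\<bar>\<delta>\<bar>\<close>\<close>
        define p where "p = (Q + C) * sqrt (real n)"
        have "1 * Q \<le> sqrt (real n) * Q" using elim(1) Q by (intro mult_right_mono) auto
        then have p1: "Q + \<bar>\<delta>\<bar> \<le> p" using \<delta> by (simp add: p_def algebra_simps)
        have sn: "sqrt (real n) * sqrt (real n) = real n" by simp
        have "2 * (Q + C) \<le> sqrt (real n)" using elim(2) by (rule real_le_rsqrt)
        then have "2 * (Q + C) * sqrt (real n) \<le> sqrt (real n) * sqrt (real n)" by (intro mult_right_mono) auto
        moreover have "2 * (Q + C) * sqrt (real n) = 2 * p" by (simp add: p_def)
        ultimately have p2: "2 * p \<le> \<omega>" using \<omega>n(1) sn by linarith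
        obtain a b :: complex where "0 < norm a + norm b"
          "norm (b * ?z - \<delta> * a) \<le> 2 * p\<^sup>2 / \<omega> * (norm a + norm b)"
          "norm (a * cnj ?z - \<delta> * b) \<le> 2 * p\<^sup>2 / \<omega> * (norm a + norm b)"
          using amp[OF p1 p2] by blast
        then have "\<bar>\<bar>\<delta>\<bar> - norm ?z\<bar> \<le> 2 * (2 * p\<^sup>2 / \<omega>)" by (rule resonance_splitting)
        moreover have "p\<^sup>2 / \<omega> \<le> (Q + C)\<^sup>2"
        proof -
          have "p\<^sup>2 = (Q + C)\<^sup>2 * real n" by (simp add: p_def power_mult_distrib)
          also have "\<dots> \<le> (Q + C)\<^sup>2 * \<omega>" using \<omega>n by (intro mult_left_mono) auto
          finally show ?thesis using \<omega>n by (simp add: field_simps)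
        qed
        ultimately show ?thesis using zQ unfolding P_def by simp
      qed
      have P\<omega>: "2 * P \<le> \<omega>" using elim(3) \<omega>n by linarith
      obtain a b :: complex where ab: "0 < norm a + norm b"
        "\<forall>x\<in>{0..1}. norm (y x - (a * cis (\<omega> * x) + b * cis (- \<omega> * x))) \<le> 2 * P * (norm a + norm b) / \<omega>"
        "norm (b * ?z - \<delta> * a) \<le> 2 * P\<^sup>2 / \<omega> * (norm a + norm b)"
        "norm (a * cnj ?z - \<delta> * b) \<le> 2 * P\<^sup>2 / \<omega> * (norm a + norm b)"
        "norm (b * ?z - \<delta> * a) \<le> (3 * (r / 2 + \<bar>\<delta>\<bar>) * P / (2 * \<omega>) + 2 * P ^ 3 / \<omega>\<^sup>2) * (norm a + norm b)"
        "norm (a * cnj ?z - \<delta> * b) \<le> (3 * (r / 2 + \<bar>\<delta>\<bar>) * P / (2 * \<omega>) + 2 * P ^ 3 / \<omega>\<^sup>2) * (norm a + norm b)"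
        using amp[OF \<delta>P P\<omega>] by blast
      have "\<bar>\<bar>\<delta>\<bar> - norm ?z\<bar> \<le> 2 * (2 * P\<^sup>2 / \<omega>)" by (rule resonance_splitting[OF ab(1,3,4)])
      also have "2 * (2 * P\<^sup>2 / \<omega>) \<le> r / 2"
      proof -
        have "8 * P\<^sup>2 \<le> r * real n" using elim(5) r by (simp add: field_simps)
        also have "\<dots> \<le> r * \<omega>" using \<omega>n r by (intro mult_left_mono) auto
        finally have "8 * P\<^sup>2 \<le> r * \<omega>" .
        then show ?thesis using \<omega>n by (simp add: field_simps)
      qed
      finally have \<delta>r: "\<bar>\<delta>\<bar> \<le> r" using z by linarith
      have err: "3 * (r / 2 + \<bar>\<delta>\<bar>) * P / (2 * \<omega>) + 2 * P ^ 3 / \<omega>\<^sup>2 \<le> e / real n"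
      proof -
        have "3 * (r / 2 + \<bar>\<delta>\<bar>) * P / (2 * \<omega>) \<le> (e / 2) / real n"
        proof -
          have "3 * (r / 2 + \<bar>\<delta>\<bar>) * P \<le> 3 * (2 * r) * P"
            using \<delta>r P r by (intro mult_right_mono) auto
          then have a: "3 * (r / 2 + \<bar>\<delta>\<bar>) * P \<le> e / 2" using rP by simp
          show ?thesis by (rule frac_le) (use a \<omega>n n e in auto)
        qed
        moreover have "2 * P ^ 3 / \<omega>\<^sup>2 \<le> (e / 2) / real n"
        proof -
          have a: "2 * P ^ 3 \<le> e / 2 * real n" using elim(6) e by (simp add: field_simps)
          have "real n * real n \<le> \<omega> * \<omega>" using \<omega>n by (intro mult_mono) auto
          then have "2 * P ^ 3 / \<omega>\<^sup>2 \<le> (e / 2 * real n) / (real n * real n)"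
            using a n e by (intro frac_le) (auto simp: power2_eq_square)
          then show ?thesis using n by simp
        qed
        ultimately show ?thesis by (simp add: add_divide_distrib[symmetric])
      qed
      have app: "norm (y x - (a * cis (\<omega> * x) + b * cis (- \<omega> * x))) \<le> e * (norm a + norm b)" if "x \<in> {0..1}" for x
      proof -
        have "2 * P \<le> e * real n" using elim(7) e by (simp add: field_simps)
        also have "\<dots> \<le> e * \<omega>" using \<omega>n e by (intro mult_left_mono) auto
        finally have "2 * P \<le> e * \<omega>" .
        then have "2 * P / \<omega> \<le> e" using \<omega>n by (simp add: field_simps)
        then have "2 * P / \<omega> * (norm a + norm b) \<le> e * (norm a + norm b)" using ab(1) by (intro mult_right_mono) auto
        then show ?thesis using ab(2) that by force
      qed
      have "(3 * (r / 2 + \<bar>\<delta>\<bar>) * P / (2 * \<omega>) + 2 * P ^ 3 / \<omega>\<^sup>2) * (norm a + norm b) \<le> e / real n * (norm a + norm b)"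
        using err ab(1) by (intro mult_right_mono) auto
      then show "\<exists>(a::complex) (b::complex). 0 < norm a + norm b \<and>
        norm (b * ?z - of_real \<delta> * a) \<le> e / real n * (norm a + norm b) \<and>
        norm (a * cnj ?z - of_real \<delta> * b) \<le> e / real n * (norm a + norm b) \<and>
        (\<forall>x\<in>{0..1}. norm (y x - (a * cis (2 * pi * real n * x) + b * cis (- (2 * pi * real n) * x))) \<le> e * (norm a + norm b))"
        using ab(1,5,6) app unfolding \<omega>_def by (meson order_trans)
    qed
  qed
qed

section \<open>Eigenspaces and root spaces\<close>

lemma square_integrable_continuous:
  assumes "continuous_on {0..1} f"
  shows "square_integrable f"
  unfolding square_integrable_def
proof
  show "f \<in> borel_measurable (lebesgue_on {0..1})"
    using assms by (intro continuous_imp_measurable_on_sets_lebesgue) auto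
  show "integrable (lebesgue_on {0..1}) (\<lambda>x. (cmod (f x))\<^sup>2)"
    using assms by (intro continuous_imp_integrable_real continuous_intros)
qed

definition eigenspace :: "(real \<Rightarrow> real) \<Rightarrow> complex \<Rightarrow> (real \<Rightarrow> complex) set" where
  "eigenspace q \<mu> = {y. periodic_op q y (\<lambda>x. \<mu> * y x)}"

lemma periodic_op_continuous: "periodic_op q y f \<Longrightarrow> continuous_on {0..1} y"
  using periodic_op_data by blast

lemma zero_in_eigenspace: "(\<lambda>x. 0) \<in> eigenspace q \<mu>"
  unfolding eigenspace_def periodic_op_def mem_Collect_eq
  by (intro exI[of _ "\<lambda>x. 0"]) (auto intro: square_integrable_continuous)

lemma eigenspace_combination:
  assumes y: "y \<in> eigenspace q \<mu>" and z: "z \<in> eigenspace q \<mu>"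
  shows "(\<lambda>x. y x - c * z x) \<in> eigenspace q \<mu>"
proof -
  obtain y1 y2 where Y: "\<forall>x. x \<notin> {0..1} \<longrightarrow> y x = 0"
    "\<forall>x\<in>{0..1}. (y has_vector_derivative y1 x) (at x within {0..1})"
    "y2 absolutely_integrable_on {0..1}" "\<forall>x\<in>{0..1}. y1 x = y1 0 + integral {0..x} y2"
    "y 1 = y 0" "y1 1 = y1 0" "AE x in lebesgue_on {0..1}. \<mu> * y x = - y2 x + of_real (q x) * y x"
    using y unfolding eigenspace_def mem_Collect_eq periodic_op_def by blast
  obtain z1 z2 where Z: "\<forall>x. x \<notin> {0..1} \<longrightarrow> z x = 0"
    "\<forall>x\<in>{0..1}. (z has_vector_derivative z1 x) (at x within {0..1})"
    "z2 absolutely_integrable_on {0..1}" "\<forall>x\<in>{0..1}. z1 x = z1 0 + integral {0..x} z2"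
    "z 1 = z 0" "z1 1 = z1 0" "AE x in lebesgue_on {0..1}. \<mu> * z x = - z2 x + of_real (q x) * z x"
    using z unfolding eigenspace_def mem_Collect_eq periodic_op_def by blast
  have cz: "(\<lambda>x. c * z2 x) absolutely_integrable_on {0..1}"
    using absolutely_integrable_mult_continuous[OF Z(3) continuous_on_const[of _ c]] by (simp add: mult.commute)
  have w2: "(\<lambda>x. y2 x - c * z2 x) absolutely_integrable_on {0..1}"
    by (rule absolutely_integrable_difference[OF Y(3) cz])
  have w1: "y1 x - c * z1 x = (y1 0 - c * z1 0) + integral {0..x} (\<lambda>x. y2 x - c * z2 x)" if x: "x \<in> {0..1}" for x
  proof -
    have "integral {0..x} (\<lambda>x. y2 x - c * z2 x) = integral {0..x} y2 - c * integral {0..x} z2"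
      using absolutely_integrable_integrable[OF absolutely_integrable_initial_segment[OF Y(3) x]] absolutely_integrable_integrable[OF absolutely_integrable_initial_segment[OF cz x]]
      by (subst integral_diff) auto
    then show ?thesis using Y(4)[rule_format, OF x] Z(4)[rule_format, OF x]
      by (simp only:) (simp add: algebra_simps)
  qed
  have ae: "AE x in lebesgue_on {0..1}. \<mu> * (y x - c * z x) = - (y2 x - c * z2 x) + of_real (q x) * (y x - c * z x)"
    using Y(7) Z(7)
  proof eventually_elim
    case (elim x)
    have "\<mu> * (y x - c * z x) = \<mu> * y x - c * (\<mu> * z x)" by (simp add: algebra_simps)
    also have "\<dots> = - (y2 x - c * z2 x) + of_real (q x) * (y x - c * z x)"
      unfolding elim by (simp add: algebra_simps)
    finally show ?case .
  qed
  have c: "continuous_on {0..1} (\<lambda>x. \<mu> * (y x - c * z x))"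
    using y z by (intro continuous_intros) (auto simp: eigenspace_def dest: periodic_op_continuous)
  have d: "((\<lambda>x. y x - c * z x) has_vector_derivative y1 x - c * z1 x) (at x within {0..1})" if "x \<in> {0..1}" for x
    using Y(2) Z(2) that by (intro has_vector_derivative_diff has_vector_derivative_mult_right) auto
  show ?thesis
    unfolding eigenspace_def periodic_op_def mem_Collect_eq
  proof (intro exI conjI)
    show "\<forall>x. x \<notin> {0..1} \<longrightarrow> y x - c * z x = 0" using Y(1) Z(1) by simp
    show "\<forall>x\<in>{0..1}. ((\<lambda>x. y x - c * z x) has_vector_derivative y1 x - c * z1 x) (at x within {0..1})"
      using d by blast
    show "(\<lambda>x. y2 x - c * z2 x) absolutely_integrable_on {0..1}" by (rule w2)
    show "\<forall>x\<in>{0..1}. y1 x - c * z1 x = y1 0 - c * z1 0 + integral {0..x} (\<lambda>x. y2 x - c * z2 x)"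
      using w1 by blast
    show "y 1 - c * z 1 = y 0 - c * z 0" by (simp only: Y(5) Z(5))
    show "y1 1 - c * z1 1 = y1 0 - c * z1 0" by (simp only: Y(6) Z(6))
    show "square_integrable (\<lambda>x. \<mu> * (y x - c * z x))" by (rule square_integrable_continuous[OF c])
  qed (rule ae)
qed

lemma eigenvectors_orthogonal:
  assumes q: "q absolutely_integrable_on {0..1}" and "\<mu>1 \<noteq> \<mu>2"
    and y: "y \<in> eigenspace q (of_real \<mu>1)" and z: "z \<in> eigenspace q (of_real \<mu>2)"
  shows "integral {0..1} (\<lambda>x. y x * cnj (z x)) = 0"
proof -
  have "integral {0..1} (\<lambda>x. (of_real \<mu>1 * y x) * cnj (z x)) = integral {0..1} (\<lambda>x. y x * cnj (of_real \<mu>2 * z x))"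
    by (rule periodic_op_symmetric[OF q _ periodic_op_cnj]) (use y z in \<open>simp_all add: eigenspace_def\<close>)
  then have "of_real \<mu>1 * integral {0..1} (\<lambda>x. y x * cnj (z x)) = of_real \<mu>2 * integral {0..1} (\<lambda>x. y x * cnj (z x))"
    by (simp add: mult.assoc mult.left_commute[of "y _"])
  then show ?thesis using assms(2) by simp
qed

text \<open>
  If \<open>(L - \<mu>) y = z\<close> with \<open>z\<close> an eigenfunction, then \<open>(z, z) = ((L - \<mu>) y, z) = (y, (L - \<mu>) z) = 0\<close>, so there are
  no root functions beyond the eigenfunctions. Positivity of \<open>(z, z)\<close> enters as a hypothesis since it
  is a case of the non-orthogonality established for large eigenvalues.
\<close>

lemma root_space_subset_eigenspace:
  assumes q: "q absolutely_integrable_on {0..1}"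
    and pos: "\<And>z. z \<in> eigenspace q (of_real \<mu>) \<Longrightarrow> z \<noteq> (\<lambda>x. 0) \<Longrightarrow> integral {0..1} (\<lambda>x. z x * cnj (z x)) \<noteq> 0"
    and y: "y \<in> root_space q (of_real \<mu>)"
  shows "y \<in> eigenspace q (of_real \<mu>)"
  using y
proof induction
  case zero
  show ?case by (rule zero_in_eigenspace)
next
  case (step z y)
  have yc: "continuous_on {0..1} y" and zc: "continuous_on {0..1} z"
    using step periodic_op_continuous by (auto simp: eigenspace_def)
  have "periodic_op q z (\<lambda>x. of_real \<mu> * z x)" using step by (simp add: eigenspace_def)
  from periodic_op_symmetric[OF q step(2) periodic_op_cnj[OF this]]
  have "integral {0..1} (\<lambda>x. (of_real \<mu> * y x + z x) * cnj (z x)) = integral {0..1} (\<lambda>x. of_real \<mu> * (y x * cnj (z x)))"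
    by (simp add: mult_ac)
  moreover have "integral {0..1} (\<lambda>x. (of_real \<mu> * y x + z x) * cnj (z x))
    = integral {0..1} (\<lambda>x. of_real \<mu> * (y x * cnj (z x)) + z x * cnj (z x))"
    by (simp add: distrib_right mult.assoc)
  moreover have "\<dots> = integral {0..1} (\<lambda>x. of_real \<mu> * (y x * cnj (z x))) + integral {0..1} (\<lambda>x. z x * cnj (z x))"
    by (intro integral_add integrable_continuous_real continuous_intros yc zc)
  ultimately have "integral {0..1} (\<lambda>x. z x * cnj (z x)) = 0" by simp
  then have "z = (\<lambda>x. 0)" using pos step(3) by blast
  then show ?case using step(2) by (simp add: eigenspace_def)
qed

text \<open>
  A chain in the root space that ends in a nonzero function passes through an eigenfunction.
\<close>

lemma eigenfunction_obtains:
  assumes "eigenvalue_mult q \<mu> \<ge> 1"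
  obtains y where "y \<in> eigenspace q \<mu>" "y \<noteq> (\<lambda>x. 0)"
proof -
  obtain B where B: "B \<subseteq> root_space q \<mu>" "cfun.independent B" "card B = eigenvalue_mult q \<mu>"
    unfolding eigenvalue_mult_def using cfun.basis_exists by metis
  then have "B \<noteq> {}" using assms by auto
  then obtain w where w: "w \<in> B" by blast
  have "w \<noteq> 0" using B(2) w cfun.dependent_zero by blast
  then have w0: "w \<noteq> (\<lambda>x. 0)" by (simp add: zero_fun_def)
  have "\<exists>y\<in>eigenspace q \<mu>. y \<noteq> (\<lambda>x. 0)" if "w \<in> root_space q \<mu>" "w \<noteq> (\<lambda>x. 0)"
    using that
  proof induction
    case (step z y)
    show ?case
    proof (cases "z = (\<lambda>x. 0)")
      case True
      then have "y \<in> eigenspace q \<mu>" using step(2) by (simp add: eigenspace_def)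
      then show ?thesis using step by blast
    qed (use step in blast)
  qed simp
  then show ?thesis using that w w0 B(1) by blast
qed

text \<open>
  Of two linearly independent eigenfunctions, one can be made orthogonal to the other.
\<close>

lemma eigenvalue_mult_le_1:
  assumes q: "q absolutely_integrable_on {0..1}"
    and nonorth: "\<And>y z. y \<in> eigenspace q (of_real \<mu>) \<Longrightarrow> z \<in> eigenspace q (of_real \<mu>) \<Longrightarrow>
      y \<noteq> (\<lambda>x. 0) \<Longrightarrow> z \<noteq> (\<lambda>x. 0) \<Longrightarrow> integral {0..1} (\<lambda>x. y x * cnj (z x)) \<noteq> 0"
  shows "eigenvalue_mult q (of_real \<mu>) \<le> 1"
proof (rule ccontr)
  assume "\<not> ?thesis"
  then have ge2: "eigenvalue_mult q (of_real \<mu>) \<ge> 2" by simp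
  obtain B where B: "B \<subseteq> root_space q (of_real \<mu>)" "cfun.independent B" "card B = eigenvalue_mult q (of_real \<mu>)"
    unfolding eigenvalue_mult_def using cfun.basis_exists by metis
  have "finite B" using ge2 B(3) by (intro card_ge_0_finite) simp
  moreover have "\<not> card B \<le> Suc 0" using ge2 B(3) by simp
  ultimately obtain y z where yz: "y \<in> B" "z \<in> B" "y \<noteq> z"
    using card_le_Suc0_iff_eq by blast
  have nz: "w \<noteq> (\<lambda>x. 0)" if "w \<in> B" for w
  proof -
    have "w \<noteq> 0" using B(2) that cfun.dependent_zero by blast
    then show ?thesis by (simp add: zero_fun_def)
  qed
  have E: "y \<in> eigenspace q (of_real \<mu>)" "z \<in> eigenspace q (of_real \<mu>)"
  proof -
    have "w \<in> eigenspace q (of_real \<mu>)" if "w \<in> B" for w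
      by (rule root_space_subset_eigenspace[OF q _ subsetD[OF B(1) that]]) (rule nonorth)
    then show "y \<in> eigenspace q (of_real \<mu>)" "z \<in> eigenspace q (of_real \<mu>)" using yz by simp_all
  qed
  have yc: "continuous_on {0..1} y" and zc: "continuous_on {0..1} z"
    using E by (auto simp: eigenspace_def dest: periodic_op_continuous)
  define c where "c = integral {0..1} (\<lambda>x. y x * cnj (z x)) / integral {0..1} (\<lambda>x. z x * cnj (z x))"
  have zz: "integral {0..1} (\<lambda>x. z x * cnj (z x)) \<noteq> 0" using nonorth E(2) nz yz by blast
  have "integral {0..1} (\<lambda>x. (y x - c * z x) * cnj (z x)) = integral {0..1} (\<lambda>x. y x * cnj (z x) - c * (z x * cnj (z x)))"
    by (simp add: left_diff_distrib mult.assoc)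
  also have "\<dots> = integral {0..1} (\<lambda>x. y x * cnj (z x)) - integral {0..1} (\<lambda>x. c * (z x * cnj (z x)))"
    by (intro integral_diff integrable_continuous_real continuous_intros yc zc)
  also have "\<dots> = 0" using zz by (simp add: c_def)
  finally have "(\<lambda>x. y x - c * z x) = (\<lambda>x. 0)"
    using nonorth[OF eigenspace_combination[OF E] E(2) _ nz[OF yz(2)]] by blast
  then have "y = (\<lambda>x. c * z x)" by (simp add: fun_eq_iff)
  moreover have "(\<lambda>x. c * z x) \<in> cfun.span (B - {y})"
    by (rule cfun.span_scale[OF cfun.span_base]) (use yz in auto)
  ultimately show False using B(2) yz(1) cfun.dependent_def by metis
qed

section \<open>Asymptotics and simplicity of the eigenvalues\<close>

lemma eigenvalue_splitting:
  assumes q: "q absolutely_integrable_on {0..1}" "integral {0..1} q = 0" and C: "C \<ge> 0" and e: "e > 0"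
  shows "\<forall>\<^sub>F n in sequentially. \<forall>\<delta> y. \<bar>\<delta>\<bar> \<le> C * sqrt (real n) \<longrightarrow>
      y \<in> eigenspace q (of_real ((2 * pi * real n)\<^sup>2 + \<delta>)) \<longrightarrow> y \<noteq> (\<lambda>x. 0) \<longrightarrow>
      \<bar>\<bar>\<delta>\<bar> - cmod (fourier_coeff q (2 * int n))\<bar> \<le> e / real n"
  using eigenfunction_asymptotics[OF q C half_gt_zero[OF e]]
proof eventually_elim
  case (elim n)
  show ?case
  proof (intro allI impI)
    fix \<delta> y
    assume "\<bar>\<delta>\<bar> \<le> C * sqrt (real n)" "y \<in> eigenspace q (of_real ((2 * pi * real n)\<^sup>2 + \<delta>))" "y \<noteq> (\<lambda>x. 0)"
    then obtain a b :: complex where ab: "0 < norm a + norm b"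
      "norm (b * fourier_coeff q (2 * int n) - of_real \<delta> * a) \<le> e / 2 / real n * (norm a + norm b)"
      "norm (a * cnj (fourier_coeff q (2 * int n)) - of_real \<delta> * b) \<le> e / 2 / real n * (norm a + norm b)"
      using elim unfolding eigenspace_def by blast
    show "\<bar>\<bar>\<delta>\<bar> - cmod (fourier_coeff q (2 * int n))\<bar> \<le> e / real n"
      using resonance_splitting[OF ab] by simp
  qed
qed

text \<open>
  The relative error \<open>\<epsilon>/30\<close> is what \<open>resonance_direction\<close> asks for, and \<open>1/20\<close> is the closeness required in
  \<open>aligned_not_orthogonal\<close>.
\<close>

lemma same_side_not_orthogonal:
  assumes q: "q absolutely_integrable_on {0..1}" "integral {0..1} q = 0" and C: "C \<ge> 0" and \<epsilon>: "\<epsilon> > 0"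
  shows "\<forall>\<^sub>F n in sequentially. \<epsilon> / real n \<le> cmod (fourier_coeff q (2 * int n)) \<longrightarrow>
     (\<forall>\<delta>1 \<delta>2 y1 y2. \<bar>\<delta>1\<bar> \<le> C * sqrt (real n) \<longrightarrow> \<bar>\<delta>2\<bar> \<le> C * sqrt (real n) \<longrightarrow>
      y1 \<in> eigenspace q (of_real ((2 * pi * real n)\<^sup>2 + \<delta>1)) \<longrightarrow> y1 \<noteq> (\<lambda>x. 0) \<longrightarrow>
      y2 \<in> eigenspace q (of_real ((2 * pi * real n)\<^sup>2 + \<delta>2)) \<longrightarrow> y2 \<noteq> (\<lambda>x. 0) \<longrightarrow>
      \<delta>1 \<noteq> 0 \<longrightarrow> sgn \<delta>1 = sgn \<delta>2 \<longrightarrow> integral {0..1} (\<lambda>x. y1 x * cnj (y2 x)) \<noteq> 0)"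
proof -
  define e where "e = min (\<epsilon> / 30) (1 / 20)"
  have e: "e > 0" "30 * e \<le> \<epsilon>" "e \<le> 1 / 20" using \<epsilon> by (auto simp: e_def)
  show ?thesis
    using eigenfunction_asymptotics[OF q C e(1)] eventually_gt_at_top[of 0]
  proof eventually_elim
    case (elim n)
    let ?z = "fourier_coeff q (2 * int n)"
    show ?case
    proof (intro impI allI)
      fix \<delta>1 \<delta>2 y1 y2
      assume z: "\<epsilon> / real n \<le> cmod ?z"
        and 1: "\<bar>\<delta>1\<bar> \<le> C * sqrt (real n)" "y1 \<in> eigenspace q (of_real ((2 * pi * real n)\<^sup>2 + \<delta>1))" "y1 \<noteq> (\<lambda>x. 0)"
        and 2: "\<bar>\<delta>2\<bar> \<le> C * sqrt (real n)" "y2 \<in> eigenspace q (of_real ((2 * pi * real n)\<^sup>2 + \<delta>2))" "y2 \<noteq> (\<lambda>x. 0)"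
        and \<delta>: "\<delta>1 \<noteq> 0" "sgn \<delta>1 = sgn \<delta>2"
      have n: "real n > 0" using elim(2) by simp
      have "0 < \<epsilon> / real n" using \<epsilon> n by simp
      then have z0: "?z \<noteq> 0" using z by auto
      have "30 * (e / real n) \<le> \<epsilon> / real n" using e(2) n by (simp add: divide_right_mono)
      then have z30: "30 * (e / real n) \<le> cmod ?z" using z by linarith
      have \<delta>2: "\<delta>2 \<noteq> 0" using \<delta> by (metis sgn_zero sgn_zero_iff)
      obtain a1 b1 :: complex where ab1: "0 < norm a1 + norm b1"
        "norm (b1 * ?z - of_real \<delta>1 * a1) \<le> e / real n * (norm a1 + norm b1)"
        "norm (a1 * cnj ?z - of_real \<delta>1 * b1) \<le> e / real n * (norm a1 + norm b1)"
        "\<forall>x\<in>{0..1}. norm (y1 x - (a1 * cis (2 * pi * real n * x) + b1 * cis (- (2 * pi * real n) * x))) \<le> e * (norm a1 + norm b1)"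
        using elim(1) 1 unfolding eigenspace_def by blast
      obtain a2 b2 :: complex where ab2: "0 < norm a2 + norm b2"
        "norm (b2 * ?z - of_real \<delta>2 * a2) \<le> e / real n * (norm a2 + norm b2)"
        "norm (a2 * cnj ?z - of_real \<delta>2 * b2) \<le> e / real n * (norm a2 + norm b2)"
        "\<forall>x\<in>{0..1}. norm (y2 x - (a2 * cis (2 * pi * real n * x) + b2 * cis (- (2 * pi * real n) * x))) \<le> e * (norm a2 + norm b2)"
        using elim(1) 2 unfolding eigenspace_def by blast
      have es: "e * s \<le> s / 20" if "s > 0" for s using e(3) that mult_right_mono[of e "1/20" s] by simp
      show "integral {0..1} (\<lambda>x. y1 x * cnj (y2 x)) \<noteq> 0"
      proof (rule aligned_not_orthogonal)
        show "2 * pi * real n \<noteq> 0" using n by simp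
        show "cis (2 * pi * real n) = 1" using cis_multiple_2pi[of "real n"] by simp
        show "continuous_on {0..1} y1" "continuous_on {0..1} y2"
          using 1 2 by (auto simp: eigenspace_def dest: periodic_op_continuous)
        show "cmod (complex_of_real (sgn \<delta>1) * sgn ?z) = 1"
          using \<delta>(1) z0 by (simp add: norm_mult norm_sgn abs_sgn_eq)
        show "cmod (a1 - complex_of_real (sgn \<delta>1) * sgn ?z * b1) \<le> (cmod a1 + cmod b1) / 10"
          by (rule resonance_direction[OF ab1(1-3) z30 z0 \<delta>(1)])
        show "cmod (a2 - complex_of_real (sgn \<delta>1) * sgn ?z * b2) \<le> (cmod a2 + cmod b2) / 10"
          unfolding \<delta>(2) by (rule resonance_direction[OF ab2(1-3) z30 z0 \<delta>2])
        show "cmod (y1 x - (a1 * cis (2 * pi * real n * x) + b1 * cis (- (2 * pi * real n) * x))) \<le> (cmod a1 + cmod b1) / 20"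
          if "x \<in> {0..1}" for x
          using order_trans[OF ab1(4)[rule_format, OF that] es[OF ab1(1)]] .
        show "cmod (y2 x - (a2 * cis (2 * pi * real n * x) + b2 * cis (- (2 * pi * real n) * x))) \<le> (cmod a2 + cmod b2) / 20"
          if "x \<in> {0..1}" for x
          using order_trans[OF ab2(4)[rule_format, OF that] es[OF ab2(1)]] .
      qed (use ab1(1) ab2(1) in auto)
    qed
  qed
qed

text \<open>
  An equal pair occupies two indices of the listing and so uses up multiplicity two.
\<close>

lemma large_periodic_eigenvaluesD:
  assumes ev: "large_periodic_eigenvalues q N\<^sub>0 ev"
  shows "\<exists>C\<ge>0.
    \<forall>\<^sub>F n in sequentially. ev n 1 \<le> ev n 2 \<and> (ev n 1 = ev n 2 \<longrightarrow> eigenvalue_mult q (of_real (ev n 1)) \<ge> 2) \<and>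
      (\<forall>j\<in>{1, 2}. \<bar>ev n j - (2 * pi * real n)\<^sup>2\<bar> \<le> C * sqrt (real n) \<and> eigenvalue_mult q (of_real (ev n j)) \<ge> 1)"
proof -
  have O: "(\<lambda>n. ev n j - (2 * pi * real n)\<^sup>2) \<in> O(\<lambda>n. sqrt (real n))" if "j \<in> {1, 2}" for j
    using ev that unfolding large_periodic_eigenvalues_def by blast
  obtain C1 where C1: "C1 > 0" "\<forall>\<^sub>F n in sequentially. norm (ev n 1 - (2 * pi * real n)\<^sup>2) \<le> C1 * norm (sqrt (real n))"
    using landau_o.bigE[OF O[of 1]] by auto
  obtain C2 where C2: "C2 > 0" "\<forall>\<^sub>F n in sequentially. norm (ev n 2 - (2 * pi * real n)\<^sup>2) \<le> C2 * norm (sqrt (real n))"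
    using landau_o.bigE[OF O[of 2]] by auto
  have idx: "finite (index_set N\<^sub>0 ev \<mu>)" "card (index_set N\<^sub>0 ev \<mu>) \<le> eigenvalue_mult q \<mu>" for \<mu>
    using ev unfolding large_periodic_eigenvalues_def by blast+
  have le: "ev n 1 \<le> ev n 2" if "n \<ge> N\<^sub>0" for n
    using ev that unfolding large_periodic_eigenvalues_def by blast
  show ?thesis
  proof (intro exI[of _ "C1 + C2"] conjI)
    show "C1 + C2 \<ge> 0" using C1 C2 by simp
    show "\<forall>\<^sub>F n in sequentially. ev n 1 \<le> ev n 2 \<and> (ev n 1 = ev n 2 \<longrightarrow> eigenvalue_mult q (of_real (ev n 1)) \<ge> 2) \<and>
      (\<forall>j\<in>{1, 2}. \<bar>ev n j - (2 * pi * real n)\<^sup>2\<bar> \<le> (C1 + C2) * sqrt (real n) \<and> eigenvalue_mult q (of_real (ev n j)) \<ge> 1)"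
      using C1(2) C2(2) eventually_ge_at_top[of N\<^sub>0]
    proof eventually_elim
      case (elim n)
      have m: "(n, j) \<in> index_set N\<^sub>0 ev (of_real (ev n j))" if "j \<in> {1, 2}" for j
        using that elim(3) by (auto simp: index_set_def)
      have m1: "eigenvalue_mult q (of_real (ev n j)) \<ge> 1" if "j \<in> {1, 2}" for j
      proof -
        have "card {(n, j)} \<le> card (index_set N\<^sub>0 ev (of_real (ev n j)))"
          by (rule card_mono[OF idx(1)]) (use m[OF that] in simp)
        then show ?thesis using idx(2)[of "of_real (ev n j)"] by simp
      qed
      have m2: "eigenvalue_mult q (of_real (ev n 1)) \<ge> 2" if eq: "ev n 1 = ev n 2"
      proof -
        have "card {(n, 1::nat), (n, 2)} \<le> card (index_set N\<^sub>0 ev (of_real (ev n 1)))"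
          by (rule card_mono[OF idx(1)]) (use m[of 1] m[of 2] eq in simp)
        then show ?thesis using idx(2)[of "of_real (ev n 1)"] by simp
      qed
      have "C1 * sqrt (real n) \<le> (C1 + C2) * sqrt (real n)" "C2 * sqrt (real n) \<le> (C1 + C2) * sqrt (real n)"
        using C1 C2 by (auto intro!: mult_right_mono)
      then have "\<bar>ev n j - (2 * pi * real n)\<^sup>2\<bar> \<le> (C1 + C2) * sqrt (real n)" if "j \<in> {1, 2}" for j
        using elim(1,2) that by auto
      then show ?case using m1 m2 le[OF elim(3)] by blast
    qed
  qed
qed

lemma listed_eigenvalue_splitting:
  assumes q: "q absolutely_integrable_on {0..1}" "integral {0..1} q = 0"
    and ev: "large_periodic_eigenvalues q N\<^sub>0 ev" and e: "e > 0"
  shows "\<forall>\<^sub>F n in sequentially. \<forall>j\<in>{1, 2}.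
    \<bar>\<bar>ev n j - (2 * pi * real n)\<^sup>2\<bar> - cmod (fourier_coeff q (2 * int n))\<bar> \<le> e / real n"
proof -
  obtain C where C: "C \<ge> 0"
    "\<forall>\<^sub>F n in sequentially. ev n 1 \<le> ev n 2 \<and> (ev n 1 = ev n 2 \<longrightarrow> eigenvalue_mult q (of_real (ev n 1)) \<ge> 2) \<and>
      (\<forall>j\<in>{1, 2}. \<bar>ev n j - (2 * pi * real n)\<^sup>2\<bar> \<le> C * sqrt (real n) \<and> eigenvalue_mult q (of_real (ev n j)) \<ge> 1)"
    using large_periodic_eigenvaluesD[OF ev] by blast
  show ?thesis
    using C(2) eigenvalue_splitting[OF q C(1) e]
  proof eventually_elim
    case (elim n)
    show ?case
    proof
      fix j :: nat assume j: "j \<in> {1, 2}"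
      then have d: "\<bar>ev n j - (2 * pi * real n)\<^sup>2\<bar> \<le> C * sqrt (real n)" and m: "eigenvalue_mult q (of_real (ev n j)) \<ge> 1"
        using elim(1) by blast+
      obtain y where "y \<in> eigenspace q (of_real (ev n j))" "y \<noteq> (\<lambda>x. 0)"
        using eigenfunction_obtains[OF m] .
      then show "\<bar>\<bar>ev n j - (2 * pi * real n)\<^sup>2\<bar> - cmod (fourier_coeff q (2 * int n))\<bar> \<le> e / real n"
        using elim(2)[rule_format, OF d, of y] by simp
    qed
  qed
qed

text \<open>
  Non-orthogonality on one side makes the eigenvalues simple, so \<open>ev n 1\<close> and \<open>ev n 2\<close> are different.
  Neither equals \<open>(2 \<pi> n)\<^sup>2\<close>, and if both were on the same side of it, then their eigenfunctions would be
  orthogonal by symmetry of the operator and yet not orthogonal.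
\<close>

lemma separated_eigenvalues:
  assumes q: "q absolutely_integrable_on {0..1}" "integral {0..1} q = 0"
    and ev: "large_periodic_eigenvalues q N\<^sub>0 ev" and \<epsilon>: "\<epsilon> > 0"
  shows "\<forall>\<^sub>F n in sequentially. \<epsilon> / real n \<le> cmod (fourier_coeff q (2 * int n)) \<longrightarrow>
    (\<forall>j\<in>{1, 2}. simple_eigenvalue q (of_real (ev n j))) \<and>
    ev n 1 < (2 * pi * real n)\<^sup>2 \<and> (2 * pi * real n)\<^sup>2 < ev n 2"
proof -
  obtain C where C: "C \<ge> 0"
    "\<forall>\<^sub>F n in sequentially. ev n 1 \<le> ev n 2 \<and> (ev n 1 = ev n 2 \<longrightarrow> eigenvalue_mult q (of_real (ev n 1)) \<ge> 2) \<and>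
      (\<forall>j\<in>{1, 2}. \<bar>ev n j - (2 * pi * real n)\<^sup>2\<bar> \<le> C * sqrt (real n) \<and> eigenvalue_mult q (of_real (ev n j)) \<ge> 1)"
    using large_periodic_eigenvaluesD[OF ev] by blast
  show ?thesis
    using C(2) same_side_not_orthogonal[OF q C(1) \<epsilon>] listed_eigenvalue_splitting[OF q ev half_gt_zero[OF \<epsilon>]]
      eventually_gt_at_top[of 0]
  proof eventually_elim
    case (elim n)
    show ?case
    proof
      assume z: "\<epsilon> / real n \<le> cmod (fourier_coeff q (2 * int n))"
      define \<delta> where "\<delta> j = ev n j - (2 * pi * real n)\<^sup>2" for j
      have ev_eq: "ev n j = (2 * pi * real n)\<^sup>2 + \<delta> j" for j by (simp add: \<delta>_def)
      have \<delta>C: "\<bar>\<delta> j\<bar> \<le> C * sqrt (real n)" and mult: "eigenvalue_mult q (of_real (ev n j)) \<ge> 1" if "j \<in> {1, 2}" for j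
        using elim(1) that unfolding \<delta>_def by blast+
      have \<delta>0: "\<delta> j \<noteq> 0" if "j \<in> {1, 2}" for j
      proof
        assume "\<delta> j = 0"
        then have "cmod (fourier_coeff q (2 * int n)) \<le> \<epsilon> / 2 / real n"
          using elim(3)[rule_format, OF that] by (simp add: \<delta>_def)
        then have "\<epsilon> / real n \<le> \<epsilon> / 2 / real n" using z by linarith
        then show False using \<epsilon> elim(4) by (simp add: field_simps)
      qed
      have nonorth: "integral {0..1} (\<lambda>x. y x * cnj (w x)) \<noteq> 0"
        if "i \<in> {1, 2}" "j \<in> {1, 2}" "sgn (\<delta> i) = sgn (\<delta> j)"
          "y \<in> eigenspace q (of_real (ev n i))" "w \<in> eigenspace q (of_real (ev n j))"
          "y \<noteq> (\<lambda>x. 0)" "w \<noteq> (\<lambda>x. 0)" for i j y w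
        using elim(2) z \<delta>C[OF that(1)] \<delta>C[OF that(2)] \<delta>0[OF that(1)] that unfolding ev_eq by blast
      have le1: "eigenvalue_mult q (of_real (ev n j)) \<le> 1" if "j \<in> {1, 2}" for j
        by (rule eigenvalue_mult_le_1[OF q(1)]) (rule nonorth[OF that that refl])
      have simple: "simple_eigenvalue q (of_real (ev n j))" if "j \<in> {1, 2}" for j
        using le1[OF that] mult[OF that] unfolding simple_eigenvalue_def by simp
      have ne: "ev n 1 \<noteq> ev n 2" using elim(1) le1[of 1] by auto
      have "sgn (\<delta> 1) \<noteq> sgn (\<delta> 2)"
      proof
        assume sg: "sgn (\<delta> 1) = sgn (\<delta> 2)"
        obtain y where y: "y \<in> eigenspace q (of_real (ev n 1))" "y \<noteq> (\<lambda>x. 0)"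
          using eigenfunction_obtains[OF mult[of 1]] by blast
        obtain w where w: "w \<in> eigenspace q (of_real (ev n 2))" "w \<noteq> (\<lambda>x. 0)"
          using eigenfunction_obtains[OF mult[of 2]] by blast
        show False
          using nonorth[OF _ _ sg y(1) w(1) y(2) w(2)] eigenvectors_orthogonal[OF q(1) ne y(1) w(1)] by simp
      qed
      moreover have "\<delta> 1 \<le> \<delta> 2" using elim(1) by (simp add: \<delta>_def)
      ultimately have "\<delta> 1 < 0" "0 < \<delta> 2" using \<delta>0[of 1] \<delta>0[of 2] by (auto simp: sgn_if split: if_splits)
      then show "(\<forall>j\<in>{1, 2}. simple_eigenvalue q (of_real (ev n j))) \<and>
        ev n 1 < (2 * pi * real n)\<^sup>2 \<and> (2 * pi * real n)\<^sup>2 < ev n 2"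
        using simple unfolding \<delta>_def by auto
    qed
  qed
qed

theorem corollary1:
  fixes q :: "real \<Rightarrow> real" and N\<^sub>0 :: nat and ev :: "nat \<Rightarrow> nat \<Rightarrow> real"
  assumes "\<And>x. q (x + 1) = q x"
    and "q absolutely_integrable_on {0..1}"
    and "integral {0..1} q = 0"
    and "large_periodic_eigenvalues q N\<^sub>0 ev"
  shows
    "((\<lambda>n. fourier_coeff q (2 * int n)) \<in> o(\<lambda>n. 1 / of_nat n) \<longrightarrow>
        (\<forall>j\<in>{1, 2}. (\<lambda>n. ev n j - (2 * pi * real n)\<^sup>2) \<in> o(\<lambda>n. 1 / real n))) \<and>
     (\<forall>\<epsilon>>0. \<forall>\<^sub>F N in sequentially.
        (\<forall>n\<in>N1_set q \<epsilon> N. \<forall>j\<in>{1, 2}. simple_eigenvalue q (complex_of_real (ev n j))) \<and>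
        (\<forall>j\<in>{1, 2}.
           (\<lambda>n. ev n j - ((2 * pi * real n)\<^sup>2 + (-1) ^ j * cmod (fourier_coeff q (2 * int n))))
             \<in> o[inf sequentially (principal (N1_set q \<epsilon> N))](\<lambda>n. 1 / real n)))"
proof (intro conjI impI allI ballI)
  note splitting = listed_eigenvalue_splitting[OF assms(2-4)]
  {
    fix j :: nat assume j: "j \<in> {1, 2}"
    assume small: "(\<lambda>n. fourier_coeff q (2 * int n)) \<in> o(\<lambda>n. 1 / of_nat n)"
    show "(\<lambda>n. ev n j - (2 * pi * real n)\<^sup>2) \<in> o(\<lambda>n. 1 / real n)"
    proof (rule landau_o.smallI)
      fix c :: real assume c: "c > 0"
      show "\<forall>\<^sub>F n in sequentially. norm (ev n j - (2 * pi * real n)\<^sup>2) \<le> c * norm (1 / real n)"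
        using splitting[OF half_gt_zero[OF c]] landau_o.smallD[OF small half_gt_zero[OF c]]
      proof eventually_elim
        case (elim n)
        have "norm (1 / of_nat n :: complex) = 1 / real n" by (simp add: norm_divide)
        then have "cmod (fourier_coeff q (2 * int n)) \<le> c / 2 / real n" using elim(2) by simp
        moreover have "c / 2 / real n + c / 2 / real n = c * norm (1 / real n)" by simp
        ultimately show ?case using elim(1)[rule_format, OF j] unfolding real_norm_def by linarith
      qed
    qed
  }
  fix \<epsilon> :: real assume \<epsilon>: "\<epsilon> > 0"
  note sep = separated_eigenvalues[OF assms(2-4) \<epsilon>]
  have o: "(\<lambda>n. ev n j - ((2 * pi * real n)\<^sup>2 + (-1) ^ j * cmod (fourier_coeff q (2 * int n))))
      \<in> o[inf sequentially (principal (N1_set q \<epsilon> N))](\<lambda>n. 1 / real n)" if j: "j \<in> {1, 2}" for j N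
  proof (rule landau_o.smallI)
    fix c :: real assume c: "c > 0"
    show "\<forall>\<^sub>F n in inf sequentially (principal (N1_set q \<epsilon> N)).
        norm (ev n j - ((2 * pi * real n)\<^sup>2 + (-1) ^ j * cmod (fourier_coeff q (2 * int n)))) \<le> c * norm (1 / real n)"
      unfolding eventually_inf_principal
      using splitting[OF c] sep
    proof eventually_elim
      case (elim n)
      show ?case
      proof
        assume "n \<in> N1_set q \<epsilon> N"
        then have "\<epsilon> / real n \<le> cmod (fourier_coeff q (2 * int n))" by (simp add: N1_set_def)
        then have lt: "ev n 1 < (2 * pi * real n)\<^sup>2" "(2 * pi * real n)\<^sup>2 < ev n 2" using elim(2) by auto
        have "c * norm (1 / real n) = c / real n" by simp
        moreover have "\<bar>ev n j - ((2 * pi * real n)\<^sup>2 + (-1) ^ j * cmod (fourier_coeff q (2 * int n)))\<bar>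
          = \<bar>\<bar>ev n j - (2 * pi * real n)\<^sup>2\<bar> - cmod (fourier_coeff q (2 * int n))\<bar>"
          using j lt by auto
        ultimately show "norm (ev n j - ((2 * pi * real n)\<^sup>2 + (-1) ^ j * cmod (fourier_coeff q (2 * int n)))) \<le> c * norm (1 / real n)"
          using elim(1)[rule_format, OF j] by simp
      qed
    qed
  qed
  obtain M where M: "\<And>n. n \<ge> M \<Longrightarrow> \<epsilon> / real n \<le> cmod (fourier_coeff q (2 * int n)) \<Longrightarrow>
      \<forall>j\<in>{1, 2}. simple_eigenvalue q (of_real (ev n j))"
    using sep unfolding eventually_sequentially by blast
  show "\<forall>\<^sub>F N in sequentially.
        (\<forall>n\<in>N1_set q \<epsilon> N. \<forall>j\<in>{1, 2}. simple_eigenvalue q (complex_of_real (ev n j))) \<and>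
        (\<forall>j\<in>{1, 2}.
           (\<lambda>n. ev n j - ((2 * pi * real n)\<^sup>2 + (-1) ^ j * cmod (fourier_coeff q (2 * int n))))
             \<in> o[inf sequentially (principal (N1_set q \<epsilon> N))](\<lambda>n. 1 / real n))"
    using eventually_ge_at_top[of M]
  proof eventually_elim
    case (elim N)
    have "\<forall>j\<in>{1, 2}. simple_eigenvalue q (complex_of_real (ev n j))" if "n \<in> N1_set q \<epsilon> N" for n
      by (rule M) (use that elim in \<open>auto simp: N1_set_def\<close>)
    then show ?case using o by blast
  qed
qed

end
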